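(* Let $\Gamma$ be a rectifiable Jordan curve which is locally a Carleson curve at $t\in\Gamma$, let $p\in\mathcal{P}_t$, and let $w\in A_{L^{p(\cdot)}}(\Gamma,t)$. Then for every $\gamma\in N_t:=\{\gamma\in\mathbb{C}:\varphi_{t,\gamma}w\in A_{L^{p(\cdot)}}(\Gamma,t)\}$, $$\alpha_t^*(\operatorname{Im}\gamma)=\frac1{p(t)}+\alpha_t(\operatorname{Im}\gamma),\qquad\beta_t^*(\operatorname{Im}\gamma)=\frac1{p(t)}+\beta_t(\operatorname{Im}\gamma).$$
   Context: Curve. A rectifiable Jordan curve $\Gamma\subset\mathbb{C}$ (homeomorphic to a circle) carries Lebesgue length measure $|d\tau|$; $|\Omega|$ is the measure of a measurable $\Omega\subset\Gamma$. For $t\in\Gamma$, $R>0$: $\Gamma(t,R)=\{\tau\in\Gamma:|\tau-t|<R\}$, $d_t=\max_{\tau\in\Gamma}|\tau-t|$, $\Delta(t,R)=\Gamma(t,R)\setminus\Gamma(t,R/2)$. $\Gamma$ is locally a Carleson curve at $t$ if $\sup_{R>0}|\Gamma(t,R)|/R<\infty$. A weight is a measurable $w:\Gamma\to[0,\infty]$ with $0<w<\infty$ a.e. Nakano spaces. For measurable $p:\Gamma\to[1,\infty)$ let $m(f,p)=\int_\Gamma|f(\tau)|^{p(\tau)}|d\tau|$; $X=L^{p(\cdot)}$ is the space of measurable $f:\Gamma\to\mathbb{C}$ with $m(\lambda f,p)<\infty$ for some $\lambda>0$, with norm $\|f\|_X=\inf\{\lambda>0:m(f/\lambda,p)\le1\}$.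 Its associate space $X'$ has norm $\|g\|_{X'}=\sup\{\int_\Gamma|fg|\,|d\tau|:\|f\|_X\le1\}$. $\mathcal{P}_t$ is the class of continuous $p:\Gamma\to(1,\infty)$ for which there is $A_t>0$ with $|p(\tau)-p(t)|\le A_t/(-\log|\tau-t|)$ for all $\tau\in\Gamma(t,1/2)$. $A_X(\Gamma,t)$ is the class of weights $w$ with $\sup_{R>0}\frac1R\|w\chi_{\Gamma(t,R)}\|_X\|\chi_{\Gamma(t,R)}/w\|_{X'}<\infty$. Functions. With a continuous branch of $\arg(\tau-t)$ on $\Gamma\setminus\{t\}$: $\eta_t(\tau)=e^{-\arg(\tau-t)}$ and $\varphi_{t,\gamma}(\tau)=|\tau-t|^{\operatorname{Re}\gamma}\eta_t(\tau)^{\operatorname{Im}\gamma}$, $\gamma\in\mathbb{C}$. Indices. $\Phi:(0,\infty)\to(0,\infty]$ is regular if bounded in an open neighborhood of $1$, submultiplicative if $\Phi(xy)\le\Phi(x)\Phi(y)$ for all $x,y>0$. For regular submultiplicative $\Phi$: $\alpha(\Phi)=\sup_{x\in(0,1)}\frac{\log\Phi(x)}{\log x}$, $\beta(\Phi)=\inf_{x\in(1,\infty)}\frac{\log\Phi(x)}{\log x}$. For a weight $v$ put $G_v(R_1,R_2)=\|v\chi_{\Delta(t,R_1)}\|_X\|\chi_{\Delta(t,R_2)}/v\|_{X'}/|\Delta(t,R_2)|$; $(Q_tv)(x)=\sup_{0<R\le d_t}G_v(xR,R)$ for $x\in(0,1]$ and $(Q_tv)(x)=\sup_{0<R\le d_t}G_v(R,x^{-1}R)$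 for $x>1$; $H_v(R_1,R_2)=\exp(\Omega_t(\log v,R_1))/\exp(\Omega_t(\log v,R_2))$ with $\Omega_t(f,R)=\frac1{|\Gamma(t,R)|}\int_{\Gamma(t,R)}f\,|d\tau|$; $(V_tv)(x)=\sup_{0<R\le d_t}H_v(xR,R)$ for $x\in(0,1]$ and $(V_tv)(x)=\sup_{0<R\le d_t}H_v(R,x^{-1}R)$ for $x>1$. For $x\in\mathbb{R}$: $\alpha_t^*(x)=\alpha(Q_t(\eta_t^xw))$, $\beta_t^*(x)=\beta(Q_t(\eta_t^xw))$, $\alpha_t(x)=\alpha(V_t(\eta_t^xw))$, $\beta_t(x)=\beta(V_t(\eta_t^xw))$ (well defined under the hypotheses). *)

theory Defs
  imports "HOL-Analysis.Analysis"
begin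

section \<open>Rectifiable curves and length measure\<close>

text \<open>Supremum of the lengths of all polygonal lines inscribed in the arc of \<open>g\<close> over \<open>[a,b]\<close>.\<close>

definition path_length :: "(real \<Rightarrow> 'a::metric_space) \<Rightarrow> real \<Rightarrow> real \<Rightarrow> ennreal" where
  "path_length g a b =
     (SUP xs \<in> {xs. sorted xs \<and> set xs \<subseteq> {a..b}}.
        \<Sum>i<length xs - 1. ennreal (dist (g (xs ! i)) (g (xs ! Suc i))))"

definition rectifiable_path :: "(real \<Rightarrow> 'a::metric_space) \<Rightarrow> bool" where
  "rectifiable_path g \<longleftrightarrow> path_length g 0 1 < \<infinity>"

text \<open>The arc length function, extended to the real line by constants outside \<open>[0,1]\<close>.\<close>

definition arc_length :: "(real \<Rightarrow> 'a::metric_space) \<Rightarrow> real \<Rightarrow> real" where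
  "arc_length g x = enn2real (path_length g 0 (min 1 (max 0 x)))"

definition rectifiable_jordan_curve :: "(real \<Rightarrow> complex) \<Rightarrow> bool" where
  "rectifiable_jordan_curve g \<longleftrightarrow>
     simple_path g \<and> pathfinish g = pathstart g \<and> rectifiable_path g"

text \<open>
  Lebesgue length measure on the image of \<open>g\<close>: the completed image of the Stieltjes measure of
  the arc length function. Its space is \<open>path_image g\<close>. For a rectifiable Jordan curve it does
  not depend on the parametrization. Below, the curve enters only through this measure
  \<open>M\<close>, and the point set of the curve is \<open>space M\<close>.
\<close>

definition length_measure :: "(real \<Rightarrow> complex) \<Rightarrow> complex measure" where
  "length_measure g =
     completion (distr (restrict_space (interval_measure (arc_length g)) {0..1})
                       (restrict_space borel (path_image g)) g)"

definition portion :: "complex measure \<Rightarrow> complex \<Rightarrow> real \<Rightarrow> complex set" where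
  "portion M t R = {\<tau> \<in> space M. cmod (\<tau> - t) < R}"

definition max_dist :: "complex measure \<Rightarrow> complex \<Rightarrow> real" where
  "max_dist M t = (SUP \<tau>\<in>space M. cmod (\<tau> - t))"

definition annulus :: "complex measure \<Rightarrow> complex \<Rightarrow> real \<Rightarrow> complex set" where
  "annulus M t R = portion M t R - portion M t (R / 2)"

definition locally_carleson :: "complex measure \<Rightarrow> complex \<Rightarrow> bool" where
  "locally_carleson M t \<longleftrightarrow> (SUP R\<in>{0<..}. emeasure M (portion M t R) / ennreal R) < \<infinity>"


section \<open>Nakano spaces\<close>

definition ennpowr :: "ennreal \<Rightarrow> real \<Rightarrow> ennreal" where
  "ennpowr x a = (if x = \<infinity> then \<infinity> else ennreal (enn2real x powr a))"

text \<open>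
  Modular and norm only depend on the modulus of a function, so they are defined for functions
  with values in \<open>[0,\<infinity>]\<close>; this also covers \<open>[0,\<infinity>]\<close>-valued weights. A measurable
  complex function \<open>f\<close> has the norm \<open>nakano_norm M p (\<lambda>\<tau>. ennreal (cmod (f \<tau>)))\<close>, which is
  infinite iff \<open>f\<close> is not in the space (infimum of the empty set).
\<close>

definition modular :: "'a measure \<Rightarrow> ('a \<Rightarrow> real) \<Rightarrow> ('a \<Rightarrow> ennreal) \<Rightarrow> ennreal" where
  "modular M p f = (\<integral>\<^sup>+ \<tau>. ennpowr (f \<tau>) (p \<tau>) \<partial>M)"

definition nakano_norm :: "'a measure \<Rightarrow> ('a \<Rightarrow> real) \<Rightarrow> ('a \<Rightarrow> ennreal) \<Rightarrow> ennreal" where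
  "nakano_norm M p f =
     (INF l \<in> {l::real. 0 < l \<and> modular M p (\<lambda>\<tau>. f \<tau> / ennreal l) \<le> 1}. ennreal l)"

definition associate_norm :: "'a measure \<Rightarrow> ('a \<Rightarrow> real) \<Rightarrow> ('a \<Rightarrow> ennreal) \<Rightarrow> ennreal" where
  "associate_norm M p h =
     (SUP f \<in> {f :: 'a \<Rightarrow> complex. f \<in> borel_measurable M \<and>
                 nakano_norm M p (\<lambda>\<tau>. ennreal (cmod (f \<tau>))) \<le> 1}.
        \<integral>\<^sup>+ \<tau>. ennreal (cmod (f \<tau>)) * h \<tau> \<partial>M)"

text \<open>At \<open>\<tau> = t\<close> both sides of the inequality are \<open>0\<close> because \<open>ln 0 = 0\<close>.\<close>

definition exponent_class :: "complex measure \<Rightarrow> complex \<Rightarrow> (complex \<Rightarrow> real) set" where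
  "exponent_class M t =
     {p. continuous_on (space M) p \<and> (\<forall>\<tau>\<in>space M. 1 < p \<tau>) \<and>
         (\<exists>A>0. \<forall>\<tau>\<in>portion M t (1/2). \<bar>p \<tau> - p t\<bar> \<le> A / (- ln (cmod (\<tau> - t))))}"

definition weight :: "'a measure \<Rightarrow> ('a \<Rightarrow> ennreal) \<Rightarrow> bool" where
  "weight M w \<longleftrightarrow> w \<in> borel_measurable M \<and> (AE \<tau> in M. 0 < w \<tau> \<and> w \<tau> < \<infinity>)"

definition muckenhoupt_class ::
    "complex measure \<Rightarrow> (complex \<Rightarrow> real) \<Rightarrow> complex \<Rightarrow> (complex \<Rightarrow> ennreal) set" where
  "muckenhoupt_class M p t =
     {w. weight M w \<and>
         (SUP R\<in>{0<..}. ennreal (1 / R) *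
            nakano_norm M p (\<lambda>\<tau>. w \<tau> * indicator (portion M t R) \<tau>) *
            associate_norm M p (\<lambda>\<tau>. indicator (portion M t R) \<tau> / w \<tau>)) < \<infinity>}"


section \<open>The functions \<open>\<eta>\<close> and \<open>\<phi>\<close>\<close>

definition arg_branch :: "complex measure \<Rightarrow> complex \<Rightarrow> (complex \<Rightarrow> real) \<Rightarrow> bool" where
  "arg_branch M t \<theta> \<longleftrightarrow>
     continuous_on (space M - {t}) \<theta> \<and>
     (\<forall>\<tau>\<in>space M - {t}. \<tau> - t = complex_of_real (cmod (\<tau> - t)) * cis (\<theta> \<tau>))"

definition eta :: "(complex \<Rightarrow> real) \<Rightarrow> complex \<Rightarrow> real" where
  "eta \<theta> \<tau> = exp (- \<theta> \<tau>)"

definition phi :: "complex \<Rightarrow> (complex \<Rightarrow> real) \<Rightarrow> complex \<Rightarrow> complex \<Rightarrow> real" where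
  "phi t \<theta> \<gamma> \<tau> = cmod (\<tau> - t) powr Re \<gamma> * eta \<theta> \<tau> powr Im \<gamma>"

definition eta_weight ::
    "(complex \<Rightarrow> real) \<Rightarrow> (complex \<Rightarrow> ennreal) \<Rightarrow> real \<Rightarrow> complex \<Rightarrow> ennreal" where
  "eta_weight \<theta> w x \<tau> = ennreal (eta \<theta> \<tau> powr x) * w \<tau>"

definition indicator_set_N ::
    "complex measure \<Rightarrow> (complex \<Rightarrow> real) \<Rightarrow> complex \<Rightarrow> (complex \<Rightarrow> real) \<Rightarrow>
     (complex \<Rightarrow> ennreal) \<Rightarrow> complex set" where
  "indicator_set_N M p t \<theta> w =
     {\<gamma>. (\<lambda>\<tau>. ennreal (phi t \<theta> \<gamma> \<tau>) * w \<tau>) \<in> muckenhoupt_class M p t}"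


section \<open>Indices of submultiplicative functions\<close>

text \<open>Functions from \<open>(0,\<infinity>)\<close> to \<open>(0,\<infinity>]\<close>; values at nonpositive arguments are irrelevant.\<close>

definition regular_function :: "(real \<Rightarrow> ennreal) \<Rightarrow> bool" where
  "regular_function \<Phi> \<longleftrightarrow>
     (\<forall>x>0. 0 < \<Phi> x) \<and>
     (\<exists>U C. open U \<and> 1 \<in> U \<and> U \<subseteq> {0<..} \<and> (\<forall>x\<in>U. \<Phi> x \<le> ennreal C))"

definition submultiplicative :: "(real \<Rightarrow> ennreal) \<Rightarrow> bool" where
  "submultiplicative \<Phi> \<longleftrightarrow> (\<forall>x>0. \<forall>y>0. \<Phi> (x * y) \<le> \<Phi> x * \<Phi> y)"

definition ennlog :: "ennreal \<Rightarrow> ereal" where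
  "ennlog y = (if y = 0 then - \<infinity> else if y = \<infinity> then \<infinity> else ereal (ln (enn2real y)))"

definition lower_index :: "(real \<Rightarrow> ennreal) \<Rightarrow> ereal" where
  "lower_index \<Phi> = (SUP x\<in>{0<..<1}. ennlog (\<Phi> x) / ereal (ln x))"

definition upper_index :: "(real \<Rightarrow> ennreal) \<Rightarrow> ereal" where
  "upper_index \<Phi> = (INF x\<in>{1<..}. ennlog (\<Phi> x) / ereal (ln x))"

definition G_fun ::
    "complex measure \<Rightarrow> (complex \<Rightarrow> real) \<Rightarrow> complex \<Rightarrow> (complex \<Rightarrow> ennreal) \<Rightarrow>
     real \<Rightarrow> real \<Rightarrow> ennreal" where
  "G_fun M p t v R\<^sub>1 R\<^sub>2 =
     nakano_norm M p (\<lambda>\<tau>. v \<tau> * indicator (annulus M t R\<^sub>1) \<tau>) *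
     associate_norm M p (\<lambda>\<tau>. indicator (annulus M t R\<^sub>2) \<tau> / v \<tau>) /
     emeasure M (annulus M t R\<^sub>2)"

definition Q_fun ::
    "complex measure \<Rightarrow> (complex \<Rightarrow> real) \<Rightarrow> complex \<Rightarrow> (complex \<Rightarrow> ennreal) \<Rightarrow> real \<Rightarrow> ennreal" where
  "Q_fun M p t v x =
     (if x \<le> 1 then SUP R\<in>{0<..max_dist M t}. G_fun M p t v (x * R) R
      else SUP R\<in>{0<..max_dist M t}. G_fun M p t v R (inverse x * R))"

definition mean_value :: "complex measure \<Rightarrow> complex \<Rightarrow> (complex \<Rightarrow> real) \<Rightarrow> real \<Rightarrow> real" where
  "mean_value M t f R = (LINT \<tau>:portion M t R|M. f \<tau>) / measure M (portion M t R)"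

text \<open>Logarithm of a weight; its values on the null set where the weight is \<open>0\<close> or \<open>\<infinity>\<close>
  do not matter.\<close>

definition log_weight :: "('a \<Rightarrow> ennreal) \<Rightarrow> 'a \<Rightarrow> real" where
  "log_weight v \<tau> = ln (enn2real (v \<tau>))"

definition H_fun ::
    "complex measure \<Rightarrow> complex \<Rightarrow> (complex \<Rightarrow> ennreal) \<Rightarrow> real \<Rightarrow> real \<Rightarrow> real" where
  "H_fun M t v R\<^sub>1 R\<^sub>2 =
     exp (mean_value M t (log_weight v) R\<^sub>1) / exp (mean_value M t (log_weight v) R\<^sub>2)"

definition V_fun ::
    "complex measure \<Rightarrow> complex \<Rightarrow> (complex \<Rightarrow> ennreal) \<Rightarrow> real \<Rightarrow> ennreal" where
  "V_fun M t v x =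
     (if x \<le> 1 then SUP R\<in>{0<..max_dist M t}. ennreal (H_fun M t v (x * R) R)
      else SUP R\<in>{0<..max_dist M t}. ennreal (H_fun M t v R (inverse x * R)))"

definition alpha_star where
  "alpha_star M p t \<theta> w x = lower_index (Q_fun M p t (eta_weight \<theta> w x))"

definition beta_star where
  "beta_star M p t \<theta> w x = upper_index (Q_fun M p t (eta_weight \<theta> w x))"

definition alpha where
  "alpha M t \<theta> w x = lower_index (V_fun M t (eta_weight \<theta> w x))"

definition beta where
  "beta M t \<theta> w x = upper_index (V_fun M t (eta_weight \<theta> w x))"

text \<open>
  The indices of a function are meant for regular submultiplicative functions only, and the mean
  values of \<open>log_weight v\<close> for integrable logarithms. This predicate says that the four indices
  above are legitimate at \<open>x\<close>; in particular they are then finite.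
\<close>

definition indices_well_defined where
  "indices_well_defined M p t \<theta> w x \<longleftrightarrow>
     (\<forall>R>0. set_integrable M (portion M t R) (log_weight (eta_weight \<theta> w x))) \<and>
     regular_function (Q_fun M p t (eta_weight \<theta> w x)) \<and>
     submultiplicative (Q_fun M p t (eta_weight \<theta> w x)) \<and>
     regular_function (V_fun M t (eta_weight \<theta> w x)) \<and>
     submultiplicative (V_fun M t (eta_weight \<theta> w x))"

end

theory Submission
  imports Defs
begin

text \<open>
  With \<open>v = \<eta>\<^sub>t\<^sup>x w\<close>, the weight \<open>u = |\<tau> - t|\<^sup>\<kappa> v\<close> (where \<open>\<kappa> = Re \<gamma>\<close>) lies in the
  Muckenhoupt class. The class gives an \<open>A\<^sub>2\<close>-type bound for the mean values of \<open>u\<close> and \<open>1/u\<close>, since the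
  log-Hoelder condition bounds the norms of the indicator of \<open>\<Gamma>(t,R)\<close> in \<open>X\<close> and \<open>X'\<close> by multiples of
  \<open>R^(1/p(t))\<close> and \<open>R^(1-1/p(t))\<close>. So \<open>log u\<close> has bounded mean oscillation at \<open>t\<close>, and by the
  Carleson condition so has \<open>log v\<close>. The Hoelder and Jensen inequalities then bound
  the norms of \<open>v \<chi>\<close> and \<open>\<chi>/v\<close> over \<open>\<Delta>(t,R)\<close> from below by multiples of \<open>exp(m) R^(1/p(t))\<close> and
  \<open>exp(-m) R^(1-1/p(t))\<close> with \<open>m = \<Omega>\<^sub>t(log v, R)\<close>. The product of the two norms is at most a
  multiple of \<open>R\<close>, because \<open>|\<tau> - t|\<^sup>\<kappa>\<close> is comparable to \<open>R\<^sup>\<kappa>\<close> on \<open>\<Delta>(t,R)\<close>, and so the lower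
  bounds are sharp up to constants. Hence \<open>(Q\<^sub>t v)(x)\<close> is comparable to \<open>x^(1/p(t)) (V\<^sub>t v)(x)\<close>, and the
  indices of submultiplicative functions do not see constant factors.
\<close>

section \<open>Length measure of a rectifiable curve\<close>

text \<open>The class hypothesis is available for u only; v itself may lie outside the Muckenhoupt
  class. Passing from log u to log v costs \<kappa> log |\<tau> - t|. Off t, the quantity |log
  |\<tau> - t| - log R| exceeds k log 2 on Gamma(t,R) only inside Gamma(t, R/2^k), whose length is
  at most C R / 2^k; summing over k bounds its integral by a multiple of R. Lower bounds on lengths
  come from connectedness: a curve through t that reaches distance R must cross the ring of width
  R/2, so |Delta(t,R)| >= R/2. Constants disappear from the indices when a comparison is tested at
  x^n: submultiplicativity raises the rest to the n-th power, while log K is divided by n. That the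
  indices are legitimate is part of the claim; submultiplicativity of Q_t is the Hoelder inequality
  on the annulus of the middle radius. One obstacle is formal: norms take values in [0,\<infinity>]
  with 0 * \<infinity> = 0, so a bound on a product of norms yields finite factors only after both
  are shown to be nonzero.\<close>

fun chain_length :: "(real \<Rightarrow> 'a::metric_space) \<Rightarrow> real list \<Rightarrow> ennreal" where
  "chain_length g [] = 0"
| "chain_length g [x] = 0"
| "chain_length g (x # y # zs) = ennreal (dist (g x) (g y)) + chain_length g (y # zs)"

text \<open>\<open>path_length\<close> sums over list indices; the recursive form admits induction
  on the chain.\<close>

lemma chain_length_eq_sum:
  "chain_length g xs = (\<Sum>i<length xs - 1. ennreal (dist (g (xs ! i)) (g (xs ! Suc i))))"
  by (induction g xs rule: chain_length.induct) (simp_all add: sum.lessThan_Suc_shift del: sum.lessThan_Suc)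

lemma path_length_eq_SUP_chain_length:
  "path_length g a b = (SUP xs \<in> {xs. sorted xs \<and> set xs \<subseteq> {a..b}}. chain_length g xs)"
  by (simp add: path_length_def chain_length_eq_sum)

lemma chain_length_le_path_length:
  assumes "sorted xs" "set xs \<subseteq> {a..b}"
  shows "chain_length g xs \<le> path_length g a b"
  unfolding path_length_eq_SUP_chain_length using assms by (intro SUP_upper) auto

lemma chain_length_append:
  "chain_length g (xs @ a # ys) = chain_length g (xs @ [a]) + chain_length g (a # ys)"
proof (induction xs)
  case (Cons x xs)
  then show ?case by (cases xs) (auto simp: add.assoc)
qed simp

lemma chain_length_Cons_mono: "chain_length g xs \<le> chain_length g (x # xs)"
  by (cases xs) auto

text \<open>The case that matters is a vertex between two neighbours, where this is the triangle
  inequality. Refining chains at prescribed parameters rests on it.\<close>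

lemma chain_length_insert: "chain_length g (xs @ ys) \<le> chain_length g (xs @ a # ys)"
proof (induction xs)
  case (Cons x xs)
  show ?case
  proof (cases xs)
    case Nil
    show ?thesis
    proof (cases ys)
      case (Cons y zs)
      have "ennreal (dist (g x) (g y)) \<le> ennreal (dist (g x) (g a)) + ennreal (dist (g a) (g y))"
        by (simp add: dist_triangle flip: ennreal_plus)
      then show ?thesis
        by (simp add: Nil Cons add.assoc[symmetric] add_right_mono)
    qed (simp add: Nil)
  next
    case (Cons y zs)
    then show ?thesis using Cons.IH by (auto intro: add_left_mono)
  qed
qed (simp add: chain_length_Cons_mono)

lemma path_length_mono:
  assumes "a' \<le> a" "b \<le> b'"
  shows "path_length g a b \<le> path_length g a' b'"
  unfolding path_length_eq_SUP_chain_length using assms by (intro SUP_subset_mono) auto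

lemma dist_le_path_length:
  assumes "a \<le> b"
  shows "ennreal (dist (g a) (g b)) \<le> path_length g a b"
  using chain_length_le_path_length[of "[a, b]" a b g] assms by simp

text \<open>Chains on the two intervals are joined through the vertex \<open>b\<close>, which can be
  added to both without loss of length.\<close>

lemma path_length_superadditive:
  assumes "a \<le> b" "b \<le> c"
  shows "path_length g a b + path_length g b c \<le> path_length g a c"
proof -
  let ?A = "{xs. sorted xs \<and> set xs \<subseteq> {a..b}}" and ?B = "{xs. sorted xs \<and> set xs \<subseteq> {b..c}}"
  have ne: "?A \<noteq> {}" "?B \<noteq> {}" by (auto intro!: exI[of _ "[]"])
  have le: "chain_length g xs + chain_length g ys \<le> path_length g a c" if "xs \<in> ?A" "ys \<in> ?B" for xs ys
  proof -
    have "chain_length g xs + chain_length g ys \<le> chain_length g (xs @ [b]) + chain_length g (b # ys)"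
      using chain_length_insert[of g xs "[]" b] by (intro add_mono chain_length_Cons_mono) simp
    also have "\<dots> = chain_length g (xs @ b # ys)" by (rule chain_length_append[symmetric])
    also have "\<dots> \<le> path_length g a c"
      using that assms by (intro chain_length_le_path_length) (force simp: sorted_append)+
    finally show ?thesis .
  qed
  have "path_length g a b + path_length g b c = (SUP xs\<in>?A. SUP ys\<in>?B. chain_length g xs + chain_length g ys)"
    unfolding path_length_eq_SUP_chain_length
    using ne by (simp add: ennreal_SUP_add_left[symmetric] ennreal_SUP_add_right[symmetric])
  also have "\<dots> \<le> path_length g a c" by (intro SUP_least le)
  finally show ?thesis .
qed

text \<open>A chain that nearly realises the length of the whole path, refined by \<open>a\<close> and a point \<open>x\<close>
  just to the right of \<open>a\<close>, shows that almost no length lies between \<open>a\<close> and \<open>x\<close>.\<close>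
lemma path_length_right_continuous:
  fixes g :: "real \<Rightarrow> 'a::metric_space"
  assumes cont: "continuous_on {0..1} g" and fin: "rectifiable_path g"
    and a: "0 \<le> a" "a < 1" and e: "0 < e"
  shows "\<exists>d>0. \<forall>x. a < x \<and> x < a + d \<longrightarrow> x \<le> 1 \<and> path_length g 0 x \<le> path_length g 0 a + ennreal e"
proof -
  let ?P = "path_length g"
  have L: "?P 0 1 < \<infinity>" using fin by (simp add: rectifiable_path_def)
  obtain xs where xs: "sorted xs" "set xs \<subseteq> {0..1}" "?P 0 1 \<le> chain_length g xs + ennreal (e / 2)"
  \<comment> \<open>Subtraction in \<open>ennreal\<close> is truncated, so subtracting
    \<open>e / 2\<close> does not give a smaller value for a path of length 0; there the empty chain
    does.\<close>
  proof (cases "?P 0 1 = 0")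
    case True
    then show ?thesis using that[of "[]"] by simp
  next
    case False
    then have "?P 0 1 - ennreal (e / 2) < ?P 0 1"
      using L e by (intro ennreal_between) (auto simp: zero_less_iff_neq_zero)
    then obtain xs where "sorted xs" "set xs \<subseteq> {0..1}" "?P 0 1 - ennreal (e / 2) < chain_length g xs"
      unfolding path_length_eq_SUP_chain_length[of g 0 1] less_SUP_iff by auto
    then show ?thesis
      by (intro that[of xs]) (auto simp: ennreal_minus_le_iff add.commute dest!: less_imp_le)
  qed
  define ys zs where "ys = filter (\<lambda>x. x \<le> a) xs" and "zs = filter (\<lambda>x. \<not> x \<le> a) xs"
  have sorted_parts: "xs = ys @ zs"
    using xs(1) unfolding ys_def zs_def
    by (induction xs) (auto, metis (no_types, lifting) append.left_neutral filter_False filter_True linorder_not_le order.trans)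
  obtain d1 where d1: "0 < d1" "\<And>z. z \<in> set zs \<Longrightarrow> a + d1 \<le> z"
  proof (cases "zs = []")
    case True
    then show ?thesis using that[of 1] by simp
  next
    case False
    then have "Min (set zs) \<in> set zs" by simp
    then have "a < Min (set zs)" by (auto simp: zs_def)
    then show ?thesis using that[of "Min (set zs) - a"] by simp
  qed
  obtain d2 where d2: "0 < d2" "\<And>x. x \<in> {0..1} \<Longrightarrow> dist x a < d2 \<Longrightarrow> dist (g x) (g a) < e / 2"
    using cont a e unfolding continuous_on_iff by (metis atLeastAtMost_iff half_gt_zero less_le)
  \<comment> \<open>Within \<open>d\<close> of \<open>a\<close>, the point \<open>x\<close> precedes
    every vertex of \<open>zs\<close>, \<open>g x\<close> is within \<open>e / 2\<close> of
    \<open>g a\<close>, and \<open>x \<le> 1\<close>.\<close>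
  define d where "d = min (min d1 d2) (1 - a)"
  have d_le: "d \<le> d1" "d \<le> d2" "d \<le> 1 - a" by (auto simp: d_def)
  show ?thesis
  proof (intro exI[of _ d] conjI allI impI)
    show "0 < d" using d1 d2 a by (simp add: d_def)
  next
    fix x assume x: "a < x \<and> x < a + d"
    then show x1: "x \<le> 1" using d_le by linarith
    have "chain_length g xs \<le> chain_length g (ys @ [a] @ zs)"
      unfolding sorted_parts by (simp add: chain_length_insert)
    also have "\<dots> \<le> chain_length g ((ys @ [a]) @ x # zs)"
      using chain_length_insert[of g "ys @ [a]" zs x] by simp
    also have "\<dots> = chain_length g (ys @ [a, x]) + chain_length g (x # zs)"
      using chain_length_append[of g "ys @ [a]" x zs] by simp
    also have "chain_length g (ys @ [a, x]) = chain_length g (ys @ [a]) + ennreal (dist (g a) (g x))"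
      using chain_length_append[of g ys a "[x]"] by simp
    also have "chain_length g (ys @ [a]) \<le> ?P 0 a"
      using xs(1,2) a by (intro chain_length_le_path_length) (auto simp: ys_def sorted_append sorted_wrt_filter)
    also have "chain_length g (x # zs) \<le> ?P x 1"
    proof (rule chain_length_le_path_length)
      have *: "x \<le> z" if "z \<in> set zs" for z using d1(2)[OF that] x d_le by linarith
      then show "sorted (x # zs)" using xs(1) by (auto simp: zs_def sorted_wrt_filter)
      show "set (x # zs) \<subseteq> {x..1}" using * xs(2) x1 by (auto simp: zs_def)
    qed
    also have "dist (g a) (g x) \<le> e / 2"
      using d2(2)[of x] x x1 a d_le by (auto simp: dist_commute dist_real_def)
    finally have "chain_length g xs \<le> ?P 0 a + ennreal (e / 2) + ?P x 1"
      by (simp add: add_left_mono add_right_mono ennreal_leI)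
    then have "?P 0 x + ?P x 1 \<le> (?P 0 a + ennreal (e / 2) + ?P x 1) + ennreal (e / 2)"
      using path_length_superadditive[of 0 x 1 g] x x1 a xs(3)
      by (meson add_right_mono less_imp_le order.trans)
    also have "\<dots> = (?P 0 a + ennreal e) + ?P x 1"
      using e by (simp add: ac_simps flip: ennreal_plus)
    finally have "?P 0 x + ?P x 1 \<le> (?P 0 a + ennreal e) + ?P x 1" .
    moreover have "?P x 1 < \<infinity>" using path_length_mono[of 0 x 1 1 g] L x a by (simp add: le_less_trans)
    ultimately show "?P 0 x \<le> ?P 0 a + ennreal e"
      by (metis ennreal_add_left_cancel_le add.commute infinity_ennreal_def less_irrefl)
  qed
qed

lemma arc_length_mono:
  assumes "rectifiable_path g" "x \<le> y"
  shows "arc_length g x \<le> arc_length g y"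
  unfolding arc_length_def
proof (rule enn2real_mono)
  show "path_length g 0 (min 1 (max 0 x)) \<le> path_length g 0 (min 1 (max 0 y))"
    using assms by (intro path_length_mono) auto
  have "path_length g 0 (min 1 (max 0 y)) \<le> path_length g 0 1"
    by (intro path_length_mono) auto
  then show "path_length g 0 (min 1 (max 0 y)) < top"
    using assms by (auto simp: rectifiable_path_def)
qed

lemma arc_length_eq:
  assumes "rectifiable_path g" "x \<in> {0..1}"
  shows "ennreal (arc_length g x) = path_length g 0 x"
proof -
  have "path_length g 0 x \<le> path_length g 0 1"
    using assms by (intro path_length_mono) auto
  then have "path_length g 0 x < top"
    using assms by (auto simp: rectifiable_path_def)
  then show ?thesis using assms by (simp add: arc_length_def)
qed

lemma arc_length_nonneg: "0 \<le> arc_length g x"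
  by (simp add: arc_length_def)

lemma dist_le_arc_length_diff:
  assumes "rectifiable_path g" "0 \<le> a" "a \<le> b" "b \<le> 1"
  shows "dist (g a) (g b) \<le> arc_length g b - arc_length g a"
proof -
  have "ennreal (arc_length g a) + ennreal (dist (g a) (g b)) \<le> path_length g 0 a + path_length g a b"
    using assms by (intro add_mono dist_le_path_length) (auto simp: arc_length_eq)
  also have "\<dots> \<le> ennreal (arc_length g b)"
    using assms path_length_superadditive[of 0 a b g] by (simp add: arc_length_eq)
  finally show ?thesis
    by (simp add: arc_length_nonneg flip: ennreal_plus)
qed

text \<open>\<open>interval_measure\<close> needs right continuity to give \<open>{a<..b}\<close>
  the increment as its mass. Monotonicity reduces the claim to a small increment at one point to the
  right of \<open>a\<close>; outside [0,1) the function is constant there.\<close>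

lemma continuous_arc_length:
  fixes g :: "real \<Rightarrow> 'a::metric_space"
  assumes "continuous_on {0..1} g" "rectifiable_path g"
  shows "continuous (at_right a) (arc_length g)"
proof -
  have "\<exists>d>0. arc_length g (a + d) - arc_length g a < e" if "0 < e" for e
  proof -
    consider "a < 0" | "0 \<le> a" "a < 1" | "1 \<le> a" by linarith
    then show ?thesis
    proof cases
      case 1
      then show ?thesis using that by (intro exI[of _ "- a"]) (auto simp: arc_length_def)
    next
      case 2
      obtain d where d: "d > 0" "\<And>x. a < x \<Longrightarrow> x < a + d \<Longrightarrow>
          x \<le> 1 \<and> path_length g 0 x \<le> path_length g 0 a + ennreal (e / 2)"
        using path_length_right_continuous[OF assms 2, of "e / 2"] \<open>0 < e\<close> by (metis half_gt_zero)
      have "a + d / 2 \<le> 1" and "path_length g 0 (a + d / 2) \<le> path_length g 0 a + ennreal (e / 2)"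
        using d(2)[of "a + d / 2"] d(1) by auto
      then have "ennreal (arc_length g (a + d / 2)) \<le> ennreal (arc_length g a) + ennreal (e / 2)"
        using 2 d(1) assms by (simp add: arc_length_eq)
      also have "\<dots> = ennreal (arc_length g a + e / 2)"
        using that by (subst ennreal_plus) (auto simp: arc_length_def)
      finally have "arc_length g (a + d / 2) \<le> arc_length g a + e / 2"
        using that by (subst (asm) ennreal_le_iff) (auto simp: arc_length_def intro!: add_nonneg_nonneg)
      then show ?thesis using d(1) that by (intro exI[of _ "d / 2"]) auto
    next
      case 3
      then show ?thesis using that by (intro exI[of _ 1]) (auto simp: arc_length_def)
    qed
  qed
  then show ?thesis
    by (subst continuous_at_right_real_increasing) (auto intro!: arc_length_mono assms)
qed

lemma emeasure_arc_length_Ioc: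
  fixes g :: "real \<Rightarrow> 'a::metric_space"
  assumes "continuous_on {0..1} g" "rectifiable_path g" "a \<le> b"
  shows "emeasure (interval_measure (arc_length g)) {a<..b} = ennreal (arc_length g b - arc_length g a)"
  by (intro emeasure_interval_measure_Ioc arc_length_mono continuous_arc_length assms)

lemma space_length_measure [simp]: "space (length_measure g) = path_image g"
  by (simp add: length_measure_def space_restrict_space)

lemma sets_length_measure:
  assumes "A \<in> sets (restrict_space borel (path_image g))"
  shows "A \<in> sets (length_measure g)"
  using assms by (simp add: length_measure_def sets_completionI_sets)

lemma emeasure_length_measure:
  assumes "path g" "A \<in> sets (restrict_space borel (path_image g))"
  shows "emeasure (length_measure g) A = emeasure (interval_measure (arc_length g)) (g -` A \<inter> {0..1})"
proof -
  let ?N = "restrict_space (interval_measure (arc_length g)) {0..1::real}"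
  have sets: "sets ?N = sets (restrict_space borel {0..1})"
    by (intro sets_restrict_space_cong) simp
  have "g \<in> measurable (restrict_space borel {0..1}) (restrict_space borel (path_image g))"
    using assms(1) by (intro measurable_restrict_space2 borel_measurable_continuous_on_restrict)
      (auto simp: path_def path_image_def space_restrict_space)
  then have meas: "g \<in> measurable ?N (restrict_space borel (path_image g))"
    using measurable_cong_sets[OF sets refl] by blast
  have "emeasure (length_measure g) A = emeasure ?N (g -` A \<inter> space ?N)"
    unfolding length_measure_def using assms(2) by (simp add: emeasure_distr[OF meas] emeasure_completion main_part_sets)
  also have "\<dots> = emeasure (interval_measure (arc_length g)) (g -` A \<inter> {0..1})"
    by (subst emeasure_restrict_space) (auto simp: space_restrict_space)
  finally show ?thesis .
qed

lemma finite_measure_length_measure: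
  assumes "path g" "rectifiable_path g"
  shows "finite_measure (length_measure g)"
proof
  have "emeasure (length_measure g) (space (length_measure g))
      = emeasure (interval_measure (arc_length g)) (g -` path_image g \<inter> {0..1})"
    using assms sets.top[of "restrict_space borel (path_image g)"]
    by (simp add: emeasure_length_measure space_restrict_space)
  \<comment> \<open>The interval is open on the left, so it starts below 0 in order to contain the
    parameter 0.\<close>
  also have "\<dots> \<le> emeasure (interval_measure (arc_length g)) {-1<..1}"
    by (intro emeasure_mono) auto
  also have "\<dots> < \<infinity>" using assms by (simp add: emeasure_arc_length_Ioc path_def)
  finally show "emeasure (length_measure g) (space (length_measure g)) \<noteq> \<infinity>" by simp
qed

section \<open>Crossing a ring: lower bounds for the length of an annulus\<close>

lemma continuous_increasing_crossing:
  fixes h :: "real \<Rightarrow> real"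
  assumes "continuous_on {c..d} h" "c \<le> d" "h c \<le> r" "r < s" "s \<le> h d"
  obtains a b where "c \<le> a" "a < b" "b \<le> d" "h a = r" "h b = s"
    "\<And>x. a \<le> x \<Longrightarrow> x \<le> b \<Longrightarrow> r \<le> h x \<and> h x \<le> s"
proof -
  have compact_level: "compact ({c..x} \<inter> h -` {y})" if "x \<le> d" for x y
    using assms(1) that
    by (auto intro!: compact_Int_closed[of "{c..x}" "{c..x} \<inter> h -` {y}", simplified Int_absorb1 Int_assoc[symmetric] Int_absorb]
        continuous_closed_preimage elim: continuous_on_subset)
  have "{c..d} \<inter> h -` {s} \<noteq> {}" using IVT'[of h c s d] assms by force
  \<comment> \<open>\<open>b\<close> is the first parameter with value \<open>s\<close>; an earlier
    value above \<open>s\<close> would give a still earlier one by the intermediate value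
    theorem.\<close>
  then obtain b where "b \<in> {c..d} \<inter> h -` {s}" "\<forall>x\<in>{c..d} \<inter> h -` {s}. b \<le> x"
    using compact_attains_inf[OF compact_level[of d s, OF order_refl]] by metis
  then have b: "b \<in> {c..d}" "h b = s" "\<And>x. x \<in> {c..d} \<Longrightarrow> h x = s \<Longrightarrow> b \<le> x"
    by simp_all
  have below: "h x \<le> s" if x: "c \<le> x" "x \<le> b" for x
  proof (rule ccontr)
    assume "\<not> h x \<le> s"
    moreover have "continuous_on {c..x} h"
      using x b(1) by (intro continuous_on_subset[OF assms(1)]) auto
    moreover have "h c \<le> s" using assms by linarith
    ultimately obtain y where "c \<le> y" "y \<le> x" "h y = s"
      using IVT'[of h c s x] x(1) by (metis linorder_le_cases)
    then have "b \<le> y" using b(1) x by (intro b(3)) auto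
    then have "y = x" using \<open>y \<le> x\<close> x by simp
    then show False using \<open>h y = s\<close> \<open>\<not> h x \<le> s\<close> by simp
  qed
  have "{c..b} \<inter> h -` {r} \<noteq> {}"
    using IVT'[of h c r b] assms b continuous_on_subset[OF assms(1), of "{c..b}"] by force
  \<comment> \<open>Symmetrically, \<open>a\<close> is the last parameter before \<open>b\<close>
    with value \<open>r\<close>.\<close>
  then obtain a where "a \<in> {c..b} \<inter> h -` {r}" "\<forall>x\<in>{c..b} \<inter> h -` {r}. x \<le> a"
    using compact_attains_sup[OF compact_level[of b r]] b(1) by (metis atLeastAtMost_iff)
  then have a: "a \<in> {c..b}" "h a = r" "\<And>x. x \<in> {c..b} \<Longrightarrow> h x = r \<Longrightarrow> x \<le> a"
    by simp_all
  have above: "r \<le> h x" if x: "a \<le> x" "x \<le> b" for x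
  proof (rule ccontr)
    assume "\<not> r \<le> h x"
    moreover have "continuous_on {x..b} h"
      using x a(1) b(1) by (intro continuous_on_subset[OF assms(1)]) auto
    moreover have "r \<le> h b" using assms b by linarith
    ultimately obtain y where "x \<le> y" "y \<le> b" "h y = r"
      using IVT'[of h x r b] x(2) by (metis linorder_le_cases)
    then have "y \<le> a" using a(1) x by (intro a(3)) auto
    then have "y = x" using \<open>x \<le> y\<close> x by simp
    then show False using \<open>h y = r\<close> \<open>\<not> r \<le> h x\<close> by simp
  qed
  show ?thesis
    using a b below above assms by (intro that[of a b]) (auto simp: less_le)
qed

text \<open>If the low point lies to the right of the high one, the function is run backwards; hence
  only the absolute value of the increment survives in the conclusion.\<close>

lemma continuous_crossing:
  fixes h :: "real \<Rightarrow> real"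
  assumes "continuous_on {c..d} h" "x \<in> {c..d}" "y \<in> {c..d}" "h x \<le> r" "r < s" "s \<le> h y"
  obtains a b where "c \<le> a" "a < b" "b \<le> d" "\<bar>h b - h a\<bar> = s - r"
    "\<And>x. a \<le> x \<Longrightarrow> x \<le> b \<Longrightarrow> r \<le> h x \<and> h x \<le> s"
proof (cases "x \<le> y")
  case True
  have "continuous_on {x..y} h"
    using assms by (auto intro: continuous_on_subset)
  from continuous_increasing_crossing[OF this True assms(4-6)]
  obtain a b where ab: "x \<le> a" "a < b" "b \<le> y" "h a = r" "h b = s"
    and between: "\<And>z. a \<le> z \<Longrightarrow> z \<le> b \<Longrightarrow> r \<le> h z \<and> h z \<le> s"
    by blast
  show ?thesis
    using assms ab by (intro that[of a b] between) auto
next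
  case False
  have "continuous_on {-x..-y} (\<lambda>z. h (- z))"
    using assms by (intro continuous_on_compose2[OF assms(1)] continuous_intros) auto
  from continuous_increasing_crossing[OF this, of r s] assms(4-6) False
  obtain a b where ab: "-x \<le> a" "a < b" "b \<le> -y" "h (-a) = r" "h (-b) = s"
    and between: "\<And>z. a \<le> z \<Longrightarrow> z \<le> b \<Longrightarrow> r \<le> h (-z) \<and> h (-z) \<le> s"
    by auto
  have "r \<le> h z \<and> h z \<le> s" if "-b \<le> z" "z \<le> -a" for z
    using between[of "-z"] that by simp
  then show ?thesis
    using assms ab by (intro that[of "-b" "-a"]) auto
qed

lemma max_dist_attained:
  assumes "path g"
  shows "\<exists>\<tau>\<in>path_image g. cmod (\<tau> - t) = max_dist (length_measure g) t"
    and "\<And>\<tau>. \<tau> \<in> path_image g \<Longrightarrow> cmod (\<tau> - t) \<le> max_dist (length_measure g) t"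
proof -
  have "continuous_on (path_image g) (\<lambda>\<tau>. cmod (\<tau> - t))"
    by (intro continuous_intros)
  from continuous_attains_sup[OF compact_path_image[OF assms] path_image_nonempty this]
  obtain \<tau> where \<tau>: "\<tau> \<in> path_image g" "\<And>\<sigma>. \<sigma> \<in> path_image g \<Longrightarrow> cmod (\<sigma> - t) \<le> cmod (\<tau> - t)"
    by blast
  have "max_dist (length_measure g) t = cmod (\<tau> - t)"
    unfolding max_dist_def using \<tau> by (intro cSup_eq_maximum) auto
  then show "\<exists>\<tau>\<in>path_image g. cmod (\<tau> - t) = max_dist (length_measure g) t"
    and "\<And>\<tau>. \<tau> \<in> path_image g \<Longrightarrow> cmod (\<tau> - t) \<le> max_dist (length_measure g) t"
    using \<tau> by auto
qed

lemma portion_sets: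
  "portion (length_measure g) t R \<in> sets (restrict_space borel (path_image g))"
proof -
  have "portion (length_measure g) t R = ball t R \<inter> path_image g"
    by (auto simp: portion_def dist_norm norm_minus_commute)
  then show ?thesis
    unfolding sets_restrict_space by (intro image_eqI[of _ _ "ball t R"]) (simp_all add: Int_commute)
qed

text \<open>The distance to \<open>t\<close> is 0 at one parameter and at least \<open>R\<close> at
  another, so it crosses from \<open>R / 2\<close> to any \<open>s < R\<close>. On the crossing
  interval the curve lies in the annulus, and its length is at least the change of distance.\<close>

lemma measure_annulus_ge:
  assumes g: "path g" "rectifiable_path g" and t: "t \<in> path_image g"
    and R: "0 < R" "R \<le> max_dist (length_measure g) t"
  shows "ennreal (R / 2) \<le> emeasure (length_measure g) (annulus (length_measure g) t R)"
proof (rule ennreal_le_epsilon)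
  fix e :: real assume e: "0 < e"
  \<comment> \<open>The annulus excludes distance \<open>R\<close>, so the crossing stops at
    \<open>s < R\<close> and loses at most \<open>e\<close>; the entry \<open>3 * R / 4\<close>
    keeps \<open>s\<close> above \<open>R / 2\<close> when \<open>e\<close> is large.\<close>
  define s where "s = max (R - e) (3 * R / 4)"
  have s: "R / 2 < s" "s < R" "R - e \<le> s" using R e by (auto simp: s_def max_def)
  define h where "h x = cmod (g x - t)" for x
  have cont_g: "continuous_on {0..1} g" using g by (simp add: path_def)
  then have "continuous_on {0..1} h" unfolding h_def by (intro continuous_intros)
  moreover obtain x where "x \<in> {0..1}" "h x \<le> R / 2"
    using t R by (auto simp: path_image_def h_def)
  moreover obtain y where "y \<in> {0..1}" "s \<le> h y"
    using max_dist_attained(1)[OF g(1), of t] R s by (auto simp: path_image_def h_def)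
  ultimately obtain a b where ab: "0 \<le> a" "a < b" "b \<le> 1" "\<bar>h b - h a\<bar> = s - R / 2"
    and between: "\<And>x. a \<le> x \<Longrightarrow> x \<le> b \<Longrightarrow> R / 2 \<le> h x \<and> h x \<le> s"
    using continuous_crossing[of 0 1 h x y "R / 2" s] s by blast
  have "\<bar>h b - h a\<bar> \<le> dist (g a) (g b)"
    unfolding h_def dist_norm using norm_triangle_ineq3[of "g b - t" "g a - t"] by (simp add: norm_minus_commute)
  also have "\<dots> \<le> arc_length g b - arc_length g a"
    using ab g by (intro dist_le_arc_length_diff) auto
  finally have "ennreal (s - R / 2) \<le> emeasure (interval_measure (arc_length g)) {a<..b}"
    using ab g cont_g by (simp add: emeasure_arc_length_Ioc ennreal_leI)
  also have "\<dots> \<le> emeasure (interval_measure (arc_length g)) (g -` annulus (length_measure g) t R \<inter> {0..1})"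
  proof (rule emeasure_mono)
    show "{a<..b} \<subseteq> g -` annulus (length_measure g) t R \<inter> {0..1}"
    proof
      fix x assume x: "x \<in> {a<..b}"
      then have "x \<in> {0..1}" "R / 2 \<le> h x" "h x < R" using ab between[of x] s by auto
      then show "x \<in> g -` annulus (length_measure g) t R \<inter> {0..1}"
        by (simp add: annulus_def portion_def path_image_def h_def)
    qed
    have "g -` annulus (length_measure g) t R \<inter> {0..1}
        = (h -` {R / 2..<R} \<inter> {0..1})"
      by (auto simp: annulus_def portion_def path_image_def h_def)
    moreover have "h \<in> borel_measurable (restrict_space borel {0..1})"
      using \<open>continuous_on {0..1} h\<close> by (rule borel_measurable_continuous_on_restrict)
    then have "h -` {R / 2..<R} \<inter> space (restrict_space borel {0..1}) \<in> sets (restrict_space borel {0..1})"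
      by (rule measurable_sets) auto
    ultimately show "g -` annulus (length_measure g) t R \<inter> {0..1} \<in> sets (interval_measure (arc_length g))"
      by (simp add: sets_restrict_space_iff space_restrict_space)
  qed
  also have "\<dots> = emeasure (length_measure g) (annulus (length_measure g) t R)"
    using g portion_sets by (subst emeasure_length_measure) (auto simp: annulus_def)
  finally have "ennreal (s - R / 2) \<le> emeasure (length_measure g) (annulus (length_measure g) t R)" .
  then have "ennreal (s - R / 2) + ennreal e \<le> emeasure (length_measure g) (annulus (length_measure g) t R) + ennreal e"
    by (rule add_right_mono)
  moreover have "ennreal (R / 2) \<le> ennreal (s - R / 2) + ennreal e"
    using s e by (simp add: ennreal_leI flip: ennreal_plus)
  ultimately show "ennreal (R / 2) \<le> emeasure (length_measure g) (annulus (length_measure g) t R) + ennreal e"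
    by order
qed

section \<open>Indices of comparable submultiplicative functions\<close>

lemma submultiplicative_power:
  assumes "submultiplicative \<Phi>" "0 < x" "0 < n"
  shows "\<Phi> (x ^ n) \<le> \<Phi> x ^ n"
  using \<open>0 < n\<close>
proof (induction n rule: nat_induct_non_zero)
  case (Suc n)
  have "\<Phi> (x ^ Suc n) \<le> \<Phi> x * \<Phi> (x ^ n)"
    using assms unfolding submultiplicative_def by simp
  also have "\<dots> \<le> \<Phi> x ^ Suc n" using Suc by (simp add: mult_left_mono)
  finally show ?case .
qed simp

lemma ennlog_ennreal: "0 < y \<Longrightarrow> ennlog (ennreal y) = ereal (ln y)"
  by (simp add: ennlog_def)

text \<open>Passage to the limit in estimates obtained at \<open>x ^ n\<close>: the share of the
  constant is \<open>c / n\<close> and vanishes.\<close>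

lemma ereal_le_of_le_add_divide:
  fixes a c :: real and b :: ereal
  assumes "\<And>n::nat. 0 < n \<Longrightarrow> ereal (a + c / real n) \<le> b"
  shows "ereal a \<le> b"
proof (rule tendsto_upperbound[where F = sequentially])
  have "(\<lambda>n. a + c / real n) \<longlonglongrightarrow> a"
    using tendsto_add[OF tendsto_const lim_const_over_n] by force
  then show "(\<lambda>n. ereal (a + c / real n)) \<longlonglongrightarrow> ereal a" by simp
  show "\<forall>\<^sub>F n in sequentially. ereal (a + c / real n) \<le> b"
    using eventually_gt_at_top[of 0] by eventually_elim (rule assms)
qed simp

lemma ereal_ge_of_ge_add_divide:
  fixes a c :: real and b :: ereal
  assumes "\<And>n::nat. 0 < n \<Longrightarrow> b \<le> ereal (a + c / real n)"
  shows "b \<le> ereal a"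
proof (rule tendsto_lowerbound[where F = sequentially])
  have "(\<lambda>n. a + c / real n) \<longlonglongrightarrow> a"
    using tendsto_add[OF tendsto_const lim_const_over_n] by force
  then show "(\<lambda>n. ereal (a + c / real n)) \<longlonglongrightarrow> ereal a" by simp
  show "\<forall>\<^sub>F n in sequentially. b \<le> ereal (a + c / real n)"
    using eventually_gt_at_top[of 0] by eventually_elim (rule assms)
qed simp

lemma ereal_add_minus_cancel:
  fixes a :: ereal
  shows "ereal s + (ereal (- s) + a) = a" "ereal (- s) + (ereal s + a) = a"
  by (cases a; simp)+

context
  fixes \<Phi> \<Psi> :: "real \<Rightarrow> ennreal" and K s :: real
  assumes submult: "submultiplicative \<Psi>" and K: "0 < K"
    and \<Phi>: "\<And>x. 0 < x \<Longrightarrow> 0 < \<Phi> x \<and> \<Phi> x < \<infinity>"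
    and \<Psi>: "\<And>x. 0 < x \<Longrightarrow> 0 < \<Psi> x \<and> \<Psi> x < \<infinity>"
    and le: "\<And>x. 0 < x \<Longrightarrow> \<Phi> x \<le> ennreal (K * x powr s) * \<Psi> x"
begin

text \<open>Comparing at \<open>x ^ n\<close> uses the factor \<open>K\<close> once, whereas
  \<open>s * ln x\<close> and the logarithm of \<open>\<Psi> x\<close> are multiplied by
  \<open>n\<close>; division by \<open>n * ln x\<close> then makes \<open>K\<close>
  negligible.\<close>

lemma ennlog_power_le:
  assumes x: "0 < x" and n: "0 < n"
  shows "\<exists>y z. ennlog (\<Phi> (x ^ n)) = ereal y \<and> ennlog (\<Psi> x) = ereal z \<and>
           y \<le> ln K + real n * (s * ln x + z)"
proof -
  obtain y z where y: "\<Phi> (x ^ n) = ennreal y" "0 < y" and z: "\<Psi> x = ennreal z" "0 < z"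
    using \<Phi>[of "x ^ n"] \<Psi>[OF x] x
    by (cases "\<Phi> (x ^ n)"; cases "\<Psi> x") auto
  have "ennreal y \<le> ennreal (K * (x ^ n) powr s) * ennreal z ^ n"
    using le[of "x ^ n"] submultiplicative_power[OF submult x n] x y z
    by (metis mult_left_mono order_trans zero_le zero_less_power)
  also have "\<dots> = ennreal (K * (x ^ n) powr s * z ^ n)"
    using K z by (simp add: ennreal_power ennreal_mult)
  finally have "y \<le> K * (x ^ n) powr s * z ^ n" using K z by (simp add: ennreal_le_iff)
  then have "ln y \<le> ln (K * (x ^ n) powr s * z ^ n)" using y by simp
  also have "\<dots> = ln K + real n * (s * ln x + ln z)"
    using K z x by (simp add: ln_mult ln_powr ln_realpow algebra_simps)
  finally show ?thesis using y z by (auto simp: ennlog_ennreal)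
qed

text \<open>On (0,1) the divisor \<open>ln x\<close> is negative, so the upper bound for
  \<open>\<Phi>\<close> turns into a lower bound for its lower index.\<close>

lemma lower_index_ge:
  "ereal s + lower_index \<Psi> \<le> lower_index \<Phi>"
proof -
  have "ereal s + ennlog (\<Psi> x) / ereal (ln x) \<le> lower_index \<Phi>" if x: "0 < x" "x < 1" for x
  proof -
    obtain z where z: "ennlog (\<Psi> x) = ereal z" using ennlog_power_le[OF x(1), of 1] by auto
    have "ereal (s + z / ln x + (ln K / ln x) / real n) \<le> lower_index \<Phi>" if n: "0 < n" for n
    proof -
      obtain y where y: "ennlog (\<Phi> (x ^ n)) = ereal y" "y \<le> ln K + real n * (s * ln x + z)"
        using ennlog_power_le[OF x(1) n] z by auto
      have neg: "real n * ln x < 0" using x n by (simp add: mult_pos_neg)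
      have "s + z / ln x + (ln K / ln x) / real n = (ln K + real n * (s * ln x + z)) / (real n * ln x)"
        using x n by (simp add: field_simps)
      also have "\<dots> \<le> y / (real n * ln x)" using y neg by (intro divide_right_mono_neg) auto
      finally have "ereal (s + z / ln x + (ln K / ln x) / real n) \<le> ennlog (\<Phi> (x ^ n)) / ereal (ln (x ^ n))"
        using y x n by (simp add: ln_realpow)
      also have "\<dots> \<le> lower_index \<Phi>"
        unfolding lower_index_def using x n by (intro SUP_upper) (auto simp: power_less_one_iff)
      finally show ?thesis .
    qed
    from ereal_le_of_le_add_divide[OF this] show ?thesis using z x by simp
  qed
  then have "(SUP x\<in>{0<..<1}. ereal s + ennlog (\<Psi> x) / ereal (ln x)) \<le> lower_index \<Phi>"
    by (intro SUP_least) auto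
  moreover have "{0<..<1::real} \<noteq> {}" by simp
  ultimately show ?thesis
    unfolding lower_index_def[of \<Psi>] by (subst SUP_ereal_add_right[symmetric]) auto
qed

lemma upper_index_le:
  "upper_index \<Phi> \<le> ereal s + upper_index \<Psi>"
proof -
  have "upper_index \<Phi> \<le> ereal s + ennlog (\<Psi> x) / ereal (ln x)" if x: "1 < x" for x
  proof -
    obtain z where z: "ennlog (\<Psi> x) = ereal z" using ennlog_power_le[of x 1] x by auto
    have "upper_index \<Phi> \<le> ereal (s + z / ln x + (ln K / ln x) / real n)" if n: "0 < n" for n
    proof -
      obtain y where y: "ennlog (\<Phi> (x ^ n)) = ereal y" "y \<le> ln K + real n * (s * ln x + z)"
        using ennlog_power_le[of x n] n x z by auto
      have pos: "0 < real n * ln x" using x n by simp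
      have "upper_index \<Phi> \<le> ennlog (\<Phi> (x ^ n)) / ereal (ln (x ^ n))"
        unfolding upper_index_def using x n by (intro INF_lower) (auto intro: one_less_power)
      also have "\<dots> = ereal (y / (real n * ln x))" using y x n by (simp add: ln_realpow)
      also have "y / (real n * ln x) \<le> (ln K + real n * (s * ln x + z)) / (real n * ln x)"
        using y pos by (intro divide_right_mono) auto
      also have "\<dots> = s + z / ln x + (ln K / ln x) / real n"
        using x n by (simp add: field_simps)
      finally show ?thesis by simp
    qed
    from ereal_ge_of_ge_add_divide[OF this] show ?thesis using z x by simp
  qed
  \<comment> \<open>The summand \<open>s\<close> moves to the left before the infimum is taken;
    being real, it cancels in \<open>ereal\<close> even against an infinite index.\<close>
  then have "ereal (- s) + upper_index \<Phi> \<le> ereal (- s) + (ereal s + ennlog (\<Psi> x) / ereal (ln x))"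
    if "1 < x" for x
    using that by (intro add_left_mono)
  then have "ereal (- s) + upper_index \<Phi> \<le> upper_index \<Psi>"
    unfolding upper_index_def[of \<Psi>] by (intro INF_greatest) (simp add: ereal_add_minus_cancel)
  then have "ereal s + (ereal (- s) + upper_index \<Phi>) \<le> ereal s + upper_index \<Psi>"
    by (intro add_left_mono)
  then show ?thesis by (simp add: ereal_add_minus_cancel)
qed

end

lemma indices_shift:
  fixes \<Phi> \<Psi> :: "real \<Rightarrow> ennreal" and K s :: real
  assumes submult: "submultiplicative \<Phi>" "submultiplicative \<Psi>" and K: "0 < K"
    and \<Phi>: "\<And>x. 0 < x \<Longrightarrow> 0 < \<Phi> x \<and> \<Phi> x < \<infinity>"
    and \<Psi>: "\<And>x. 0 < x \<Longrightarrow> 0 < \<Psi> x \<and> \<Psi> x < \<infinity>"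
    and le: "\<And>x. 0 < x \<Longrightarrow> \<Phi> x \<le> ennreal (K * x powr s) * \<Psi> x"
    and ge: "\<And>x. 0 < x \<Longrightarrow> \<Psi> x \<le> ennreal (K * x powr - s) * \<Phi> x"
  shows "lower_index \<Phi> = ereal s + lower_index \<Psi>"
    and "upper_index \<Phi> = ereal s + upper_index \<Psi>"
proof -
  have "ereal (- s) + lower_index \<Phi> \<le> lower_index \<Psi>"
    by (rule lower_index_ge[OF submult(1) K \<Psi> \<Phi> ge])
  then have "ereal s + (ereal (- s) + lower_index \<Phi>) \<le> ereal s + lower_index \<Psi>"
    by (rule add_left_mono)
  moreover have "ereal s + lower_index \<Psi> \<le> lower_index \<Phi>"
    by (rule lower_index_ge[OF submult(2) K \<Phi> \<Psi> le])
  ultimately show "lower_index \<Phi> = ereal s + lower_index \<Psi>"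
    by (simp add: ereal_add_minus_cancel)
  have "upper_index \<Psi> \<le> ereal (- s) + upper_index \<Phi>"
    by (rule upper_index_le[OF submult(1) K \<Psi> \<Phi> ge])
  then have "ereal s + upper_index \<Psi> \<le> ereal s + (ereal (- s) + upper_index \<Phi>)"
    by (rule add_left_mono)
  moreover have "upper_index \<Phi> \<le> ereal s + upper_index \<Psi>"
    by (rule upper_index_le[OF submult(2) K \<Phi> \<Psi> le])
  ultimately show "upper_index \<Phi> = ereal s + upper_index \<Psi>"
    by (simp add: ereal_add_minus_cancel)
qed

section \<open>Norms in Nakano spaces\<close>

lemma ennpowr_mono: "x \<le> y \<Longrightarrow> 0 \<le> a \<Longrightarrow> ennpowr x a \<le> ennpowr y a"
  by (auto simp: ennpowr_def top_unique less_top[symmetric] intro!: ennreal_leI powr_mono2 enn2real_mono)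

lemma ennpowr_ennreal [simp]: "0 \<le> x \<Longrightarrow> ennpowr (ennreal x) a = ennreal (x powr a)"
  by (simp add: ennpowr_def)

lemma modular_mono:
  assumes "AE \<tau> in M. f \<tau> \<le> g \<tau>" "\<And>\<tau>. \<tau> \<in> space M \<Longrightarrow> 0 \<le> p \<tau>"
  shows "modular M p f \<le> modular M p g"
  unfolding modular_def
proof (rule nn_integral_mono_AE)
  show "AE \<tau> in M. ennpowr (f \<tau>) (p \<tau>) \<le> ennpowr (g \<tau>) (p \<tau>)"
    using assms(1) by (rule AE_mp) (auto intro!: AE_I2 ennpowr_mono assms(2))
qed

lemma nakano_norm_mono:
  assumes "AE \<tau> in M. f \<tau> \<le> g \<tau>" "\<And>\<tau>. \<tau> \<in> space M \<Longrightarrow> 0 \<le> p \<tau>"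
  shows "nakano_norm M p f \<le> nakano_norm M p g"
proof -
  have "modular M p (\<lambda>\<tau>. f \<tau> / ennreal l) \<le> modular M p (\<lambda>\<tau>. g \<tau> / ennreal l)" for l
    using assms(1) by (intro modular_mono assms(2)) (auto elim!: eventually_mono intro: divide_right_mono_ennreal)
  then show ?thesis
    unfolding nakano_norm_def by (intro INF_superset_mono) (auto intro: order.trans)
qed

lemma nakano_norm_le:
  assumes "0 < l" "modular M p (\<lambda>\<tau>. f \<tau> / ennreal l) \<le> 1"
  shows "nakano_norm M p f \<le> ennreal l"
  unfolding nakano_norm_def using assms by (intro INF_lower) auto

text \<open>The strict inequality leaves room for an admissible number below \<open>l\<close>, and
  dividing by the larger \<open>l\<close> only lowers the modular.\<close>

lemma nakano_norm_less_admissible: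
  assumes "nakano_norm M p f < ennreal l" "\<And>\<tau>. \<tau> \<in> space M \<Longrightarrow> 0 \<le> p \<tau>"
  shows "modular M p (\<lambda>\<tau>. f \<tau> / ennreal l) \<le> 1"
proof -
  obtain k where k: "0 < k" "modular M p (\<lambda>\<tau>. f \<tau> / ennreal k) \<le> 1" "ennreal k < ennreal l"
    using assms(1) unfolding nakano_norm_def INF_less_iff by auto
  have "f \<tau> / ennreal l \<le> f \<tau> / ennreal k" for \<tau>
    using k unfolding divide_ennreal_def
    by (intro mult_left_mono) (auto simp: inverse_ennreal ennreal_less_iff intro!: ennreal_leI)
  then have "modular M p (\<lambda>\<tau>. f \<tau> / ennreal l) \<le> modular M p (\<lambda>\<tau>. f \<tau> / ennreal k)"
    by (intro modular_mono assms(2)) auto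
  then show ?thesis using k by simp
qed

lemma ennreal_mult_divide_cancel: "0 < c \<Longrightarrow> ennreal c * (x / ennreal c) = x"
  by (subst ennreal_times_divide, subst mult.commute, rule mult_divide_eq_ennreal) auto

lemma nakano_norm_cmult_le:
  assumes "0 < c"
  shows "nakano_norm M p (\<lambda>\<tau>. ennreal c * f \<tau>) \<le> ennreal c * nakano_norm M p f"
proof -
  have "nakano_norm M p (\<lambda>\<tau>. ennreal c * f \<tau>) / ennreal c \<le> nakano_norm M p f"
    unfolding nakano_norm_def[of M p f]
  proof (intro INF_greatest)
    fix l assume l: "l \<in> {l. 0 < l \<and> modular M p (\<lambda>\<tau>. f \<tau> / ennreal l) \<le> 1}"
    have "ennreal c * f \<tau> / ennreal (c * l) = f \<tau> / ennreal l" for \<tau>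
      using l assms divide_mult_eq[of "ennreal c" "f \<tau>" "ennreal l"]
      by (simp add: ennreal_mult mult.commute)
    then have "nakano_norm M p (\<lambda>\<tau>. ennreal c * f \<tau>) \<le> ennreal (c * l)"
      using l assms by (intro nakano_norm_le) auto
    then show "nakano_norm M p (\<lambda>\<tau>. ennreal c * f \<tau>) / ennreal c \<le> ennreal l"
      using l assms by (intro divide_le_posI_ennreal) (auto simp: ennreal_mult mult.commute)
  qed
  then have "ennreal c * (nakano_norm M p (\<lambda>\<tau>. ennreal c * f \<tau>) / ennreal c) \<le> ennreal c * nakano_norm M p f"
    by (rule mult_left_mono) simp
  then show ?thesis
    using assms by (simp add: ennreal_mult_divide_cancel)
qed

lemma associate_norm_upper:
  assumes "f \<in> borel_measurable M" "nakano_norm M p (\<lambda>\<tau>. ennreal (cmod (f \<tau>))) \<le> 1"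
  shows "(\<integral>\<^sup>+ \<tau>. ennreal (cmod (f \<tau>)) * h \<tau> \<partial>M) \<le> associate_norm M p h"
  unfolding associate_norm_def using assms by (intro SUP_upper) auto

lemma associate_norm_mono:
  assumes "AE \<tau> in M. h \<tau> \<le> k \<tau>"
  shows "associate_norm M p h \<le> associate_norm M p k"
  unfolding associate_norm_def
  using assms by (intro SUP_mono' nn_integral_mono_AE) (auto elim!: eventually_mono intro: mult_left_mono)

lemma associate_norm_cmult_le:
  assumes "h \<in> borel_measurable M"
  shows "associate_norm M p (\<lambda>\<tau>. c * h \<tau>) \<le> c * associate_norm M p h"
  unfolding associate_norm_def[of M p "\<lambda>\<tau>. c * h \<tau>"]
proof (intro SUP_least)
  fix f :: "_ \<Rightarrow> complex"
  assume f: "f \<in> {f. f \<in> borel_measurable M \<and> nakano_norm M p (\<lambda>\<tau>. ennreal (cmod (f \<tau>))) \<le> 1}"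
  have "(\<integral>\<^sup>+ \<tau>. ennreal (cmod (f \<tau>)) * (c * h \<tau>) \<partial>M) = c * (\<integral>\<^sup>+ \<tau>. ennreal (cmod (f \<tau>)) * h \<tau> \<partial>M)"
    using f assms by (subst nn_integral_cmult[symmetric]) (auto simp: ac_simps)
  also have "\<dots> \<le> c * associate_norm M p h"
    using f by (intro mult_left_mono associate_norm_upper) auto
  finally show "(\<integral>\<^sup>+ \<tau>. ennreal (cmod (f \<tau>)) * (c * h \<tau>) \<partial>M) \<le> c * associate_norm M p h" .
qed

text \<open>Finiteness of both norms excludes the junk product \<open>0 * \<infinity> = 0\<close> on the right.\<close>
lemma nakano_holder:
  assumes f: "f \<in> borel_measurable M" "AE \<tau> in M. f \<tau> < \<infinity>" and h: "h \<in> borel_measurable M"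
    and fin: "nakano_norm M p f < \<infinity>" "associate_norm M p h < \<infinity>"
    and p: "\<And>\<tau>. \<tau> \<in> space M \<Longrightarrow> 0 \<le> p \<tau>"
  shows "(\<integral>\<^sup>+ \<tau>. f \<tau> * h \<tau> \<partial>M) \<le> nakano_norm M p f * associate_norm M p h"
proof -
  let ?A = "associate_norm M p h"
  have adm: "(\<integral>\<^sup>+ \<tau>. f \<tau> * h \<tau> \<partial>M) \<le> ennreal l * ?A"
    if l: "0 < l" "modular M p (\<lambda>\<tau>. f \<tau> / ennreal l) \<le> 1" for l
  proof -
    \<comment> \<open>Test functions of the associate norm are complex-valued; as \<open>f\<close>
      is finite almost everywhere, \<open>enn2real\<close> changes it on a null set at most.\<close>
    define F where "F \<tau> = complex_of_real (enn2real (f \<tau>) / l)" for \<tau>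
    have F: "F \<in> borel_measurable M" unfolding F_def using f by measurable
    have F_eq: "AE \<tau> in M. ennreal (cmod (F \<tau>)) = f \<tau> / ennreal l"
      using f(2)
    proof eventually_elim
      case (elim \<tau>)
      then show ?case using l by (cases "f \<tau>") (auto simp: F_def divide_ennreal norm_divide)
    qed
    have "nakano_norm M p (\<lambda>\<tau>. ennreal (cmod (F \<tau>))) \<le> ennreal 1"
    proof (rule nakano_norm_le)
      have "modular M p (\<lambda>\<tau>. ennreal (cmod (F \<tau>)) / ennreal 1) \<le> modular M p (\<lambda>\<tau>. f \<tau> / ennreal l)"
        using F_eq by (intro modular_mono p) (auto simp: divide_ennreal_def elim!: eventually_mono)
      then show "modular M p (\<lambda>\<tau>. ennreal (cmod (F \<tau>)) / ennreal 1) \<le> 1" using l by simp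
    qed simp
    then have "(\<integral>\<^sup>+ \<tau>. ennreal (cmod (F \<tau>)) * h \<tau> \<partial>M) \<le> ?A"
      using F by (intro associate_norm_upper) auto
    then have "ennreal l * (\<integral>\<^sup>+ \<tau>. ennreal (cmod (F \<tau>)) * h \<tau> \<partial>M) \<le> ennreal l * ?A"
      by (rule mult_left_mono) simp
    also have "ennreal l * (\<integral>\<^sup>+ \<tau>. ennreal (cmod (F \<tau>)) * h \<tau> \<partial>M)
        = (\<integral>\<^sup>+ \<tau>. ennreal l * (ennreal (cmod (F \<tau>)) * h \<tau>) \<partial>M)"
      using F h by (intro nn_integral_cmult[symmetric]) auto
    also have "\<dots> = (\<integral>\<^sup>+ \<tau>. f \<tau> * h \<tau> \<partial>M)"
    proof (rule nn_integral_cong_AE)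
      show "AE \<tau> in M. ennreal l * (ennreal (cmod (F \<tau>)) * h \<tau>) = f \<tau> * h \<tau>"
        using F_eq
      proof eventually_elim
        case (elim \<tau>)
        have "ennreal l * (f \<tau> / ennreal l) = f \<tau>"
          using l by (simp add: ennreal_mult_divide_cancel)
        then show ?case using elim by (simp add: mult.assoc[symmetric])
      qed
    qed
    finally show ?thesis .
  qed
  obtain a where a: "?A = ennreal a" "0 \<le> a" using fin(2) by (cases ?A) auto
  show ?thesis
  \<comment> \<open>For \<open>a = 0\<close> one cannot divide by the associate norm; instead any
    admissible \<open>l\<close>, which exists because the norm of \<open>f\<close> is finite, bounds
    the integral by \<open>l * 0\<close>.\<close>
  proof (cases "a = 0")
    case True
    obtain l where "0 < l" "modular M p (\<lambda>\<tau>. f \<tau> / ennreal l) \<le> 1"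
      using fin(1) unfolding nakano_norm_def by (auto simp: INF_less_iff)
    then show ?thesis using adm True a by fastforce
  next
    case False
    have "(\<integral>\<^sup>+ \<tau>. f \<tau> * h \<tau> \<partial>M) / ?A \<le> nakano_norm M p f"
      unfolding nakano_norm_def using a False adm
      by (intro INF_greatest divide_le_posI_ennreal) (auto simp: mult.commute)
    then have "(\<integral>\<^sup>+ \<tau>. f \<tau> * h \<tau> \<partial>M) / ?A * ?A \<le> nakano_norm M p f * ?A"
      by (rule mult_right_mono) simp
    then show ?thesis
      using a False by (simp add: ennreal_mult_divide_cancel mult.commute[of _ "ennreal a"])
  qed
qed

text \<open>This is how the log-Hoelder condition acts: \<open>R powr (r / q)\<close> differs from
  \<open>R\<close> by the factor \<open>R powr ((r - q) / q)\<close>, whose logarithm is at most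
  \<open>B\<close> in modulus since \<open>1 \<le> q\<close>.\<close>

lemma powr_le_powr_of_abs_diff:
  fixes r :: real
  assumes "0 < R" "1 \<le> q" "\<bar>r - q\<bar> * \<bar>ln R\<bar> \<le> B"
  shows "R powr (r / q) \<le> R * exp B" "R powr - (r / q) \<le> exp B / R"
proof -
  have "\<bar>(r - q) / q * ln R\<bar> \<le> \<bar>r - q\<bar> * \<bar>ln R\<bar>"
    using divide_left_mono[of 1 q "\<bar>r - q\<bar> * \<bar>ln R\<bar>"] assms(2) by (simp add: abs_mult)
  then have *: "\<bar>(r - q) / q * ln R\<bar> \<le> B" using assms(3) by linarith
  have "r / q * ln R = ln R + (r - q) / q * ln R" using assms(2) by (simp add: field_simps)
  moreover have "x \<le> y + B \<and> - x \<le> B - y" if "x = y + z" "\<bar>z\<bar> \<le> B" for x y z :: real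
    using that by linarith
  ultimately have "r / q * ln R \<le> ln R + B \<and> - (r / q * ln R) \<le> B - ln R" using * by blast
  then have "exp (r / q * ln R) \<le> exp (ln R + B)" "exp (- (r / q * ln R)) \<le> exp (B - ln R)" by simp_all
  then show "R powr (r / q) \<le> R * exp B" "R powr - (r / q) \<le> exp B / R"
    using assms(1) by (simp_all add: powr_def exp_add exp_diff)
qed

lemma nakano_norm_indicator_le:
  assumes S: "S \<in> sets M" "emeasure M S \<le> ennreal (C * R)" and R: "0 < R" and C: "0 < C"
    and p: "\<And>\<tau>. \<tau> \<in> space M \<Longrightarrow> 1 \<le> p \<tau>" and q: "1 \<le> q"
    and osc: "\<And>\<tau>. \<tau> \<in> S \<Longrightarrow> \<bar>p \<tau> - q\<bar> * \<bar>ln R\<bar> \<le> B"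
  shows "nakano_norm M p (indicator S) \<le> ennreal (max 1 (C * exp B) * R powr (1 / q))"
proof (rule nakano_norm_le)
  \<comment> \<open>Since the exponent is at least 1, \<open>1 \<le> K\<close> gives
    \<open>K powr - p \<tau> \<le> 1 / K\<close>; the other entry of the maximum makes the resulting
    bound \<open>C * exp B / K\<close> of the modular at most 1.\<close>
  define K where "K = max 1 (C * exp B)"
  have K: "1 \<le> K" "C * exp B \<le> K" by (auto simp: K_def)
  show "0 < max 1 (C * exp B) * R powr (1 / q)" using K R by (simp add: K_def[symmetric])
  have pointwise: "ennpowr (indicator S \<tau> / ennreal (K * R powr (1 / q))) (p \<tau>)
      \<le> ennreal (exp B / (K * R)) * indicator S \<tau>" if \<tau>: "\<tau> \<in> space M" for \<tau>
  proof (cases "\<tau> \<in> S")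
    case True
    have "K powr p \<tau> \<ge> K powr 1" using K p[OF \<tau>] by (intro powr_mono) auto
    then have Kp: "K powr - p \<tau> \<le> 1 / K" using K by (simp add: powr_minus field_simps)
    have "(1 / (K * R powr (1 / q))) powr p \<tau> = K powr - p \<tau> * R powr - (p \<tau> / q)"
      using K R by (simp add: powr_divide powr_mult powr_powr powr_minus field_simps)
    also have "\<dots> \<le> 1 / K * (exp B / R)"
      using powr_le_powr_of_abs_diff(2)[OF R q osc[OF True]] Kp K by (intro mult_mono) auto
    finally have "(1 / (K * R powr (1 / q))) powr p \<tau> \<le> exp B / (K * R)" by simp
    then show ?thesis
      using True K R divide_ennreal[of 1 "K * R powr (1 / q)"] by (simp add: ennreal_leI)
  qed (simp add: ennpowr_def)
  have "modular M p (\<lambda>\<tau>. indicator S \<tau> / ennreal (K * R powr (1 / q)))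
      \<le> (\<integral>\<^sup>+ \<tau>. ennreal (exp B / (K * R)) * indicator S \<tau> \<partial>M)"
    unfolding modular_def by (intro nn_integral_mono pointwise)
  also have "\<dots> = ennreal (exp B / (K * R)) * emeasure M S" using S by (simp add: nn_integral_cmult_indicator)
  also have "\<dots> \<le> ennreal (exp B / (K * R)) * ennreal (C * R)" using S by (intro mult_left_mono) auto
  also have "\<dots> = ennreal (C * exp B / K)" using K R C by (simp add: ennreal_mult[symmetric] field_simps)
  also have "\<dots> \<le> 1" using K by (simp add: ennreal_le_1)
  finally show "modular M p (\<lambda>\<tau>. indicator S \<tau> / ennreal (max 1 (C * exp B) * R powr (1 / q))) \<le> 1"
    by (simp add: K_def)
qed

text \<open>In place of the conjugate exponent, \<open>y \<le> 1 + y powr p \<tau>\<close> at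
  \<open>y = cmod (f \<tau>) / 2 * R powr (1 / q)\<close> bounds a test function by a constant plus
  its modular density. The two terms contribute \<open>C * R\<close> and
  \<open>R * exp B\<close>.\<close>

lemma associate_norm_indicator_le:
  assumes S: "S \<in> sets M" "emeasure M S \<le> ennreal (C * R)" and R: "0 < R" and C: "0 < C"
    and meas: "p \<in> borel_measurable M"
    and p: "\<And>\<tau>. \<tau> \<in> space M \<Longrightarrow> 1 \<le> p \<tau>" and q: "1 \<le> q"
    and osc: "\<And>\<tau>. \<tau> \<in> S \<Longrightarrow> \<bar>p \<tau> - q\<bar> * \<bar>ln R\<bar> \<le> B"
  shows "associate_norm M p (indicator S) \<le> ennreal (2 * (C + exp B) * R powr (1 - 1 / q))"
  unfolding associate_norm_def
proof (intro SUP_least, clarify)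
  fix f :: "_ \<Rightarrow> complex"
  assume f: "f \<in> borel_measurable M" "nakano_norm M p (\<lambda>\<tau>. ennreal (cmod (f \<tau>))) \<le> 1"
  define a where "a = R powr - (1 / q)"
  have a: "0 < a" using R by (simp add: a_def)
  \<comment> \<open>Comparing with 2 rather than 1 makes the inequality strict, as
    \<open>nakano_norm_less_admissible\<close> requires; the factor 2 of the bound originates
    here.\<close>
  have "nakano_norm M p (\<lambda>\<tau>. ennreal (cmod (f \<tau>))) < ennreal 2"
    using f(2) by (rule le_less_trans) (simp flip: ennreal_1)
  then have modular: "modular M p (\<lambda>\<tau>. ennreal (cmod (f \<tau>)) / ennreal 2) \<le> 1"
    by (rule nakano_norm_less_admissible) (use p in \<open>auto intro: order.trans[OF zero_le_one]\<close>)
  have pointwise: "ennreal (cmod (f \<tau>)) * indicator S \<tau> \<le> ennreal (2 * a) *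
      (indicator S \<tau> + ennreal (R * exp B) * ennpowr (ennreal (cmod (f \<tau>)) / ennreal 2) (p \<tau>))"
    if \<tau>: "\<tau> \<in> space M" for \<tau>
  proof (cases "\<tau> \<in> S")
    case True
    define y where "y = cmod (f \<tau>) / 2 * R powr (1 / q)"
    have y: "0 \<le> y" by (simp add: y_def)
    have "y \<le> 1 + y powr p \<tau>"
    proof (cases "y \<le> 1")
      case False
      then have "y powr 1 \<le> y powr p \<tau>" using p[OF \<tau>] by (intro powr_mono) auto
      then show ?thesis using False by simp
    qed (use powr_ge_zero[of y "p \<tau>"] in linarith)
    also have "y powr p \<tau> = (cmod (f \<tau>) / 2) powr p \<tau> * R powr (p \<tau> / q)"
      unfolding y_def by (subst powr_mult) (simp_all add: powr_powr)
    also have "\<dots> \<le> (cmod (f \<tau>) / 2) powr p \<tau> * (R * exp B)"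
      using powr_le_powr_of_abs_diff(1)[OF R q osc[OF True]] by (intro mult_left_mono) auto
    finally have "2 * a * y \<le> 2 * a * (1 + (R * exp B) * (cmod (f \<tau>) / 2) powr p \<tau>)"
      using a by (intro mult_left_mono) (auto simp: mult.commute)
    moreover have "2 * a * y = cmod (f \<tau>)"
      using R by (simp add: a_def y_def powr_minus field_simps)
    ultimately have "ennreal (cmod (f \<tau>)) \<le> ennreal (2 * a * (1 + (R * exp B) * (cmod (f \<tau>) / 2) powr p \<tau>))"
      by (simp add: ennreal_leI)
    also have "\<dots> = ennreal (2 * a) * (1 + ennreal (R * exp B) * ennreal ((cmod (f \<tau>) / 2) powr p \<tau>))"
      using a R by (simp add: ennreal_mult ennreal_plus)
    finally show ?thesis using True by (simp add: ennreal_divide_numeral)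
  qed simp
  have meas': "(\<lambda>\<tau>. ennpowr (ennreal (cmod (f \<tau>)) / ennreal 2) (p \<tau>)) \<in> borel_measurable M"
    using f meas by (simp add: ennreal_divide_numeral)
  have "(\<integral>\<^sup>+ \<tau>. ennreal (cmod (f \<tau>)) * indicator S \<tau> \<partial>M)
      \<le> (\<integral>\<^sup>+ \<tau>. ennreal (2 * a) * (indicator S \<tau> + ennreal (R * exp B) * ennpowr (ennreal (cmod (f \<tau>)) / ennreal 2) (p \<tau>)) \<partial>M)"
    by (intro nn_integral_mono pointwise)
  also have "\<dots> = ennreal (2 * a) * (emeasure M S + ennreal (R * exp B) * modular M p (\<lambda>\<tau>. ennreal (cmod (f \<tau>)) / ennreal 2))"
    using S meas' unfolding modular_def by (simp add: nn_integral_cmult nn_integral_add)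
  also have "\<dots> \<le> ennreal (2 * a) * (ennreal (C * R) + ennreal (R * exp B) * 1)"
    using S modular by (intro mult_left_mono add_mono) auto
  also have "\<dots> = ennreal (2 * a * (C * R + R * exp B))"
    using a R C by (simp add: ennreal_mult ennreal_plus)
  also have "2 * a * (C * R + R * exp B) = 2 * (C + exp B) * R powr (1 - 1 / q)"
    using R by (simp add: a_def powr_diff powr_minus field_simps)
  finally show "(\<integral>\<^sup>+ \<tau>. ennreal (cmod (f \<tau>)) * indicator S \<tau> \<partial>M) \<le> ennreal (2 * (C + exp B) * R powr (1 - 1 / q))" .
qed

section \<open>Weights at a Carleson point\<close>

lemma integral_le_nn_integral:
  fixes f :: "'a \<Rightarrow> real"
  assumes "integrable M f"
  shows "ennreal (integral\<^sup>L M f) \<le> (\<integral>\<^sup>+ x. ennreal (f x) \<partial>M)"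
proof -
  have fin: "(\<integral>\<^sup>+ x. ennreal (f x) \<partial>M) < \<infinity>"
    using assms by (auto simp: real_integrable_def less_top[symmetric])
  have "integral\<^sup>L M f \<le> enn2real (\<integral>\<^sup>+ x. ennreal (f x) \<partial>M)"
    using assms by (simp add: real_lebesgue_integral_def)
  then have "ennreal (integral\<^sup>L M f) \<le> ennreal (enn2real (\<integral>\<^sup>+ x. ennreal (f x) \<partial>M))"
    by (rule ennreal_leI)
  also have "\<dots> = (\<integral>\<^sup>+ x. ennreal (f x) \<partial>M)" using fin by (simp add: less_top)
  finally show ?thesis .
qed

text \<open>Jensen's inequality by the tangent of \<open>exp\<close> at the mean \<open>c\<close>:
  exp y >= exp c * (1 - c + y). The integral of the exponential may be infinite, hence its form with
  values in [0,\<infinity>].\<close>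

lemma exp_mean_le_nn_integral:
  fixes f :: "'a \<Rightarrow> real"
  assumes "finite_measure M" "S \<in> sets M" "0 < measure M S" "set_integrable M S f"
  shows "ennreal (measure M S * exp ((LINT x:S|M. f x) / measure M S))
      \<le> (\<integral>\<^sup>+ x. ennreal (exp (f x)) * indicator S x \<partial>M)"
proof -
  interpret finite_measure M by fact
  define c where "c = (LINT x:S|M. f x) / measure M S"
  have int: "set_integrable M S (\<lambda>x. exp c * (1 - c + f x))"
    using assms by (intro set_integrable_mult_right set_integral_add)
      (auto simp: set_integrable_def integrable_indicator_iff emeasure_eq_measure)
  have const: "set_integrable M S (\<lambda>x. 1 - c)"
    using assms by (auto simp: set_integrable_def emeasure_eq_measure)
  have "(LINT x:S|M. exp c * (1 - c + f x)) = exp c * ((1 - c) * measure M S + (LINT x:S|M. f x))"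
    using set_integral_add(2)[OF const assms(4)] assms(2)
    by (simp add: set_lebesgue_integral_def sets.Int_space_eq2)
  also have "\<dots> = measure M S * exp c" using assms by (simp add: c_def field_simps)
  finally have "ennreal (measure M S * exp c) = ennreal (LINT x:S|M. exp c * (1 - c + f x))" by simp
  also have "\<dots> \<le> (\<integral>\<^sup>+ x. ennreal (indicator S x *\<^sub>R (exp c * (1 - c + f x))) \<partial>M)"
    using int unfolding set_integrable_def set_lebesgue_integral_def by (rule integral_le_nn_integral)
  also have "\<dots> \<le> (\<integral>\<^sup>+ x. ennreal (exp (f x)) * indicator S x \<partial>M)"
  proof (rule nn_integral_mono)
    fix x
    have "exp c * (1 - c + f x) \<le> exp c * exp (f x - c)"
      using exp_ge_add_one_self[of "f x - c"] by (intro mult_left_mono) (linarith, simp)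
    also have "\<dots> = exp (f x)" by (simp flip: exp_add)
    finally show "ennreal (indicator S x *\<^sub>R (exp c * (1 - c + f x))) \<le> ennreal (exp (f x)) * indicator S x"
      by (auto simp: indicator_def intro: ennreal_leI)
  qed
  finally show ?thesis by (simp add: c_def)
qed

text \<open>The constant \<open>c\<close> is arbitrary, so that means over two subsets of
  \<open>T\<close> can later be compared through the same \<open>c\<close>.\<close>

lemma mean_sub_const_le:
  fixes f :: "'a \<Rightarrow> real"
  assumes "finite_measure M" "f \<in> borel_measurable M" "S \<in> sets M" "S \<subseteq> T" "0 < measure M S"
    and osc: "(\<integral>\<^sup>+ x. ennreal \<bar>f x - c\<bar> * indicator T x \<partial>M) \<le> ennreal k" and k: "0 \<le> k"
  shows "set_integrable M S f" "\<bar>(LINT x:S|M. f x) / measure M S - c\<bar> \<le> k / measure M S"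
proof -
  interpret finite_measure M by fact
  have const: "set_integrable M S (\<lambda>x. c)"
    using assms by (auto simp: set_integrable_def emeasure_eq_measure)
  have meas: "(\<lambda>x. indicator S x *\<^sub>R (f x - c)) \<in> borel_measurable M" using assms by measurable
  have le: "(\<integral>\<^sup>+ x. ennreal (norm (indicator S x *\<^sub>R (f x - c))) \<partial>M) \<le> ennreal k"
    using assms(4) by (intro order.trans[OF nn_integral_mono osc]) (auto simp: indicator_def)
  then have int: "set_integrable M S (\<lambda>x. f x - c)"
    using meas unfolding set_integrable_def
    by (intro integrableI_bounded) (auto intro: le_less_trans)
  from set_integral_add(1)[OF int const] show intf: "set_integrable M S f" by simp
  have "ennreal (norm (LINT x:S|M. f x - c)) \<le> (\<integral>\<^sup>+ x. ennreal (norm (indicator S x *\<^sub>R (f x - c))) \<partial>M)"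
    using int unfolding set_integrable_def set_lebesgue_integral_def by (rule integral_norm_bound_ennreal)
  then have "ennreal \<bar>LINT x:S|M. f x - c\<bar> \<le> ennreal k" using le by (simp add: order.trans)
  then have "\<bar>LINT x:S|M. f x - c\<bar> \<le> k" using k by (simp add: ennreal_le_iff)
  moreover have "(LINT x:S|M. f x - c) = (LINT x:S|M. f x) - c * measure M S"
    using intf const assms by (simp add: set_integral_diff) (simp add: set_lebesgue_integral_def)
  moreover have "(LINT x:S|M. f x) / measure M S - c = ((LINT x:S|M. f x) - c * measure M S) / measure M S"
    using assms by (simp add: field_simps)
  ultimately show "\<bar>(LINT x:S|M. f x) / measure M S - c\<bar> \<le> k / measure M S"
    using assms by (simp add: divide_right_mono)
qed

text \<open>With y = x - ln a this is |y| <= exp y + exp (- y). Integrated with a suitable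
  \<open>a\<close>, it turns a bound for the product of the means of two exponentials into a bound
  for the mean oscillation.\<close>

lemma abs_diff_ln_le:
  fixes a x :: real
  assumes "0 < a"
  shows "\<bar>x - ln a\<bar> \<le> exp x / a + a * exp (- x)"
proof -
  have "x - ln a \<le> exp (x - ln a)" "ln a - x \<le> exp (ln a - x)"
    using exp_ge_add_one_self[of "x - ln a"] exp_ge_add_one_self[of "ln a - x"] by linarith+
  moreover have "exp (x - ln a) = exp x / a" "exp (ln a - x) = a * exp (- x)"
    using assms by (simp_all add: exp_diff exp_minus field_simps)
  moreover have "0 \<le> exp x / a" "0 \<le> a * exp (- x)" using assms by simp_all
  ultimately show ?thesis by linarith
qed

text \<open>What the estimates use of the curve, freed from its parametrization. Portions are open,
  so the one of radius \<open>max_dist M t\<close> misses the farthest points; the margin 1 in the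
  last assumption lets a portion be the whole curve.\<close>

locale carleson_point = finite_measure M
  for M :: "complex measure" +
  fixes t :: complex and p :: "complex \<Rightarrow> real" and C B :: real
  assumes id_measurable: "(\<lambda>\<tau>. \<tau>) \<in> borel_measurable M"
    and t_in: "t \<in> space M"
    and max_dist_pos: "0 < max_dist M t"
    and le_max_dist: "\<And>\<tau>. \<tau> \<in> space M \<Longrightarrow> cmod (\<tau> - t) \<le> max_dist M t"
    and annulus_ge: "\<And>R. 0 < R \<Longrightarrow> R \<le> max_dist M t \<Longrightarrow> R / 2 \<le> measure M (annulus M t R)"
    and portion_le: "\<And>R. 0 < R \<Longrightarrow> measure M (portion M t R) \<le> C * R"
    and p_measurable: "p \<in> borel_measurable M"
    and p_ge: "\<And>\<tau>. \<tau> \<in> space M \<Longrightarrow> 1 \<le> p \<tau>"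
    and p_osc: "\<And>R \<tau>. 0 < R \<Longrightarrow> R \<le> max_dist M t + 1 \<Longrightarrow> \<tau> \<in> portion M t R \<Longrightarrow> \<bar>p \<tau> - p t\<bar> * \<bar>ln R\<bar> \<le> B"
begin

lemma portion_sets [measurable]: "portion M t R \<in> sets M"
  unfolding portion_def using id_measurable by measurable

lemma annulus_sets [measurable]: "annulus M t R \<in> sets M"
  unfolding annulus_def by measurable

lemma annulus_subset: "annulus M t R \<subseteq> portion M t R"
  by (auto simp: annulus_def)

lemma portion_mono: "R \<le> S \<Longrightarrow> portion M t R \<subseteq> portion M t S"
  by (auto simp: portion_def)

lemma portion_ge: "0 < R \<Longrightarrow> R \<le> max_dist M t \<Longrightarrow> R / 2 \<le> measure M (portion M t R)"
  using annulus_ge finite_measure_mono[OF annulus_subset portion_sets] by (meson order.trans)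

lemma portion_pos: "0 < R \<Longrightarrow> 0 < measure M (portion M t R)"
proof -
  assume R: "0 < R"
  define r where "r = min R (max_dist M t)"
  have r: "0 < r" "r \<le> max_dist M t" "r \<le> R" using R max_dist_pos by (auto simp: r_def)
  have "0 < measure M (portion M t r)" using portion_ge[OF r(1,2)] r(1) by linarith
  also have "\<dots> \<le> measure M (portion M t R)"
    by (intro finite_measure_mono portion_mono portion_sets r)
  finally show ?thesis .
qed

lemma C_pos: "0 < C"
  using portion_le[of 1] portion_pos[of 1] by simp

lemma ln_dist_measurable [measurable]: "(\<lambda>\<tau>. ln (cmod (\<tau> - t))) \<in> borel_measurable M"
  using id_measurable by measurable

text \<open>Each dyadic portion containing \<tau> contributes \<open>ln 2\<close>, and for \<tau>
  other than t their number is about the binary logarithm of R / |\<tau> - t|.\<close>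

lemma abs_ln_dist_le_dyadic_sum:
  assumes R: "0 < R" and \<tau>: "\<tau> \<in> portion M t R"
  shows "ennreal \<bar>ln (cmod (\<tau> - t)) - ln R\<bar> \<le> (\<Sum>k. ennreal (ln 2) * indicator (portion M t (R / 2 ^ k)) \<tau>)"
proof -
  define r where "r = cmod (\<tau> - t)"
  have r: "0 \<le> r" "r < R" and space: "\<tau> \<in> space M" using \<tau> by (auto simp: r_def portion_def)
  have "\<exists>n. (\<forall>k<n. r < R / 2 ^ k) \<and> \<bar>ln r - ln R\<bar> \<le> real n * ln 2"
  proof (cases "r = 0")
    \<comment> \<open>As \<open>ln 0 = 0\<close>, the left side is |ln R| here, while
      \<open>t\<close> lies in every portion, so any \<open>n\<close> is available.\<close>
    case True
    obtain n :: nat where "\<bar>ln R\<bar> / ln 2 \<le> real n" using real_arch_simple by blast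
    then have "\<bar>ln R\<bar> \<le> real n * ln 2" by (simp add: divide_le_eq)
    then show ?thesis using R True by (intro exI[of _ n]) auto
  next
    case False
    then have pos: "0 < r" "0 < ln R - ln r" using r by auto
    define n where "n = nat \<lceil>(ln R - ln r) / ln 2\<rceil>"
    have n: "(ln R - ln r) / ln 2 \<le> real n" "real n < (ln R - ln r) / ln 2 + 1"
      using pos unfolding n_def by (auto simp: of_nat_ceiling) linarith
    have "r < R / 2 ^ k" if "k < n" for k
    proof -
      have "real k + 1 \<le> real n" using that by linarith
      then have "real k < (ln R - ln r) / ln 2" using n by linarith
      then have "real k * ln 2 + ln r < ln R" by (simp add: less_divide_eq)
      then have "ln (2 ^ k * r) < ln R" using pos by (simp add: ln_mult ln_realpow)
      then show ?thesis using pos R by (simp add: field_simps)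
    qed
    moreover have "\<bar>ln r - ln R\<bar> \<le> real n * ln 2" using n pos by (simp add: divide_le_eq)
    ultimately show ?thesis by blast
  qed
  then obtain n where n: "\<And>k. k < n \<Longrightarrow> r < R / 2 ^ k" "\<bar>ln r - ln R\<bar> \<le> real n * ln 2" by blast
  have "ennreal \<bar>ln r - ln R\<bar> \<le> ennreal (real n * ln 2)" using n by (intro ennreal_leI) auto
  also have "\<dots> = (\<Sum>k<n. ennreal (ln 2) * indicator (portion M t (R / 2 ^ k)) \<tau>)"
    using n(1) space by (simp add: portion_def r_def[symmetric] ennreal_mult ennreal_of_nat_eq_real_of_nat)
  also have "\<dots> \<le> (\<Sum>k. ennreal (ln 2) * indicator (portion M t (R / 2 ^ k)) \<tau>)"
    by (intro sum_le_suminf) auto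
  finally show ?thesis by (simp add: r_def)
qed

text \<open>By the Carleson bound the k-th dyadic portion has length at most C R / 2^k, which leaves
  a geometric series with sum 2.\<close>

lemma nn_integral_ln_dist_le:
  assumes R: "0 < R"
  shows "(\<integral>\<^sup>+ \<tau>. ennreal \<bar>ln (cmod (\<tau> - t)) - ln R\<bar> * indicator (portion M t R) \<tau> \<partial>M)
      \<le> ennreal (2 * ln 2 * C * R)"
proof -
  have "(\<integral>\<^sup>+ \<tau>. ennreal \<bar>ln (cmod (\<tau> - t)) - ln R\<bar> * indicator (portion M t R) \<tau> \<partial>M)
      \<le> (\<integral>\<^sup>+ \<tau>. (\<Sum>k. ennreal (ln 2) * indicator (portion M t (R / 2 ^ k)) \<tau>) \<partial>M)"
    using abs_ln_dist_le_dyadic_sum[OF R] by (intro nn_integral_mono) (auto simp: indicator_def)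
  also have "\<dots> = (\<Sum>k. ennreal (ln 2) * emeasure M (portion M t (R / 2 ^ k)))"
    by (subst nn_integral_suminf) (auto simp: nn_integral_cmult_indicator)
  also have "\<dots> \<le> (\<Sum>k. ennreal (ln 2 * C * R * (1 / 2) ^ k))"
  proof (rule suminf_le)
    fix k :: nat
    have "measure M (portion M t (R / 2 ^ k)) \<le> C * R * (1 / 2) ^ k"
      using portion_le[of "R / 2 ^ k"] R by (simp add: power_divide)
    then have "ln 2 * measure M (portion M t (R / 2 ^ k)) \<le> ln 2 * (C * R * (1 / 2) ^ k)"
      by (intro mult_left_mono) auto
    then show "ennreal (ln 2) * emeasure M (portion M t (R / 2 ^ k)) \<le> ennreal (ln 2 * C * R * (1 / 2) ^ k)"
      by (simp add: emeasure_eq_measure ennreal_mult[symmetric] ennreal_leI mult.assoc)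
  qed auto
  also have "\<dots> = ennreal (\<Sum>k. ln 2 * C * R * (1 / 2) ^ k)"
    using C_pos R by (intro suminf_ennreal2 summable_mult summable_geometric) auto
  also have "(\<Sum>k. ln 2 * C * R * (1 / 2) ^ k) = 2 * ln 2 * C * R"
    by (subst suminf_mult) (auto simp: suminf_geometric summable_geometric)
  finally show ?thesis .
qed

text \<open>With weights written as exponentials of real functions, the values 0 and \<infinity>
  disappear and constant factors become summands.\<close>

definition exp_norm :: "(complex \<Rightarrow> real) \<Rightarrow> complex set \<Rightarrow> ennreal" where
  "exp_norm f S = nakano_norm M p (\<lambda>\<tau>. ennreal (exp (f \<tau>)) * indicator S \<tau>)"

definition exp_assoc :: "(complex \<Rightarrow> real) \<Rightarrow> complex set \<Rightarrow> ennreal" where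
  "exp_assoc f S = associate_norm M p (\<lambda>\<tau>. ennreal (exp (- f \<tau>)) * indicator S \<tau>)"

lemma p_nonneg: "\<tau> \<in> space M \<Longrightarrow> 0 \<le> p \<tau>"
  using p_ge[of \<tau>] by simp

lemma exp_norm_mono_set: "S \<subseteq> T \<Longrightarrow> exp_norm f S \<le> exp_norm f T"
  unfolding exp_norm_def using p_nonneg by (intro nakano_norm_mono) (auto simp: indicator_def)

lemma exp_assoc_mono_set: "S \<subseteq> T \<Longrightarrow> exp_assoc f S \<le> exp_assoc f T"
  unfolding exp_assoc_def by (intro associate_norm_mono) (auto simp: indicator_def)

lemma exp_norm_scale:
  assumes "\<And>\<tau>. \<tau> \<in> S \<Longrightarrow> f \<tau> \<le> h \<tau> + k"
  shows "exp_norm f S \<le> ennreal (exp k) * exp_norm h S"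
proof -
  have "exp_norm f S \<le> nakano_norm M p (\<lambda>\<tau>. ennreal (exp k) * (ennreal (exp (h \<tau>)) * indicator S \<tau>))"
    unfolding exp_norm_def using assms p_nonneg
    by (intro nakano_norm_mono) (auto simp: indicator_def ennreal_mult[symmetric] exp_add[symmetric] add.commute)
  also have "\<dots> \<le> ennreal (exp k) * exp_norm h S"
    unfolding exp_norm_def by (intro nakano_norm_cmult_le) auto
  finally show ?thesis .
qed

lemma exp_assoc_scale:
  assumes [measurable]: "h \<in> borel_measurable M" "S \<in> sets M"
    and "\<And>\<tau>. \<tau> \<in> S \<Longrightarrow> h \<tau> \<le> f \<tau> + k"
  shows "exp_assoc f S \<le> ennreal (exp k) * exp_assoc h S"
proof -
  have "- f \<tau> \<le> k + - h \<tau>" if "\<tau> \<in> S" for \<tau> using assms(3)[OF that] by linarith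
  then have "exp_assoc f S \<le> associate_norm M p (\<lambda>\<tau>. ennreal (exp k) * (ennreal (exp (- h \<tau>)) * indicator S \<tau>))"
    unfolding exp_assoc_def
    by (intro associate_norm_mono) (auto simp: indicator_def ennreal_mult[symmetric] exp_add[symmetric])
  also have "\<dots> \<le> ennreal (exp k) * exp_assoc h S"
    unfolding exp_assoc_def by (intro associate_norm_cmult_le) measurable
  finally show ?thesis .
qed

text \<open>The constants of \<open>nakano_norm_indicator_le\<close> and
  \<open>associate_norm_indicator_le\<close>.\<close>

definition "cn = max 1 (C * exp B)"
definition "ca = 2 * (C + exp B)"

lemma cn_pos: "0 < cn" and ca_pos: "0 < ca"
  using C_pos by (auto simp: cn_def ca_def intro: add_pos_pos)

context
  fixes S R
  assumes S [measurable]: "S \<in> sets M" and sub: "S \<subseteq> portion M t R"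
    and R: "0 < R" "R \<le> max_dist M t + 1"
begin

lemma emeasure_le_of_subset_portion: "emeasure M S \<le> ennreal (C * R)"
proof -
  have "measure M S \<le> measure M (portion M t R)" by (rule finite_measure_mono[OF sub portion_sets])
  then show ?thesis using portion_le[OF R(1)] by (simp add: emeasure_eq_measure ennreal_leI)
qed

lemma nakano_indicator_le: "nakano_norm M p (indicator S) \<le> ennreal (cn * R powr (1 / p t))"
  unfolding cn_def using R sub p_osc
  by (intro nakano_norm_indicator_le emeasure_le_of_subset_portion C_pos p_ge t_in S) auto

lemma associate_indicator_le: "associate_norm M p (indicator S) \<le> ennreal (ca * R powr (1 - 1 / p t))"
  unfolding ca_def using R sub p_osc
  by (intro associate_norm_indicator_le emeasure_le_of_subset_portion C_pos p_ge t_in S p_measurable) auto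

lemma nn_integral_exp_le_exp_norm:
  assumes f [measurable]: "f \<in> borel_measurable M" and fin: "exp_norm f S < \<infinity>"
  shows "(\<integral>\<^sup>+ \<tau>. ennreal (exp (f \<tau>)) * indicator S \<tau> \<partial>M) \<le> exp_norm f S * ennreal (ca * R powr (1 - 1 / p t))"
proof -
  have "(\<integral>\<^sup>+ \<tau>. ennreal (exp (f \<tau>)) * indicator S \<tau> * indicator S \<tau> \<partial>M)
      \<le> exp_norm f S * associate_norm M p (indicator S)"
    unfolding exp_norm_def
  proof (rule nakano_holder)
    show "associate_norm M p (indicator S) < \<infinity>"
      using associate_indicator_le by (rule le_less_trans) simp
  qed (use fin p_nonneg in \<open>auto simp: exp_norm_def indicator_def\<close>)
  also have "\<dots> \<le> exp_norm f S * ennreal (ca * R powr (1 - 1 / p t))"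
    using associate_indicator_le by (intro mult_left_mono) auto
  finally show ?thesis by (simp add: mult.assoc indicator_inter_arith[symmetric])
qed

lemma nn_integral_exp_le_exp_assoc:
  assumes f [measurable]: "f \<in> borel_measurable M" and fin: "exp_assoc f S < \<infinity>"
  shows "(\<integral>\<^sup>+ \<tau>. ennreal (exp (- f \<tau>)) * indicator S \<tau> \<partial>M) \<le> ennreal (cn * R powr (1 / p t)) * exp_assoc f S"
proof -
  have "(\<integral>\<^sup>+ \<tau>. indicator S \<tau> * (ennreal (exp (- f \<tau>)) * indicator S \<tau>) \<partial>M)
      \<le> nakano_norm M p (indicator S) * exp_assoc f S"
    unfolding exp_assoc_def
  proof (rule nakano_holder)
    show "nakano_norm M p (indicator S) < \<infinity>"
      using nakano_indicator_le by (rule le_less_trans) simp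
  qed (use fin p_nonneg in \<open>auto simp: exp_assoc_def indicator_def\<close>)
  also have "\<dots> \<le> ennreal (cn * R powr (1 / p t)) * exp_assoc f S"
    using nakano_indicator_le by (intro mult_right_mono) auto
  also have "(\<integral>\<^sup>+ \<tau>. indicator S \<tau> * (ennreal (exp (- f \<tau>)) * indicator S \<tau>) \<partial>M)
      = (\<integral>\<^sup>+ \<tau>. ennreal (exp (- f \<tau>)) * indicator S \<tau> \<partial>M)"
    by (intro nn_integral_cong) (simp add: indicator_def)
  finally show ?thesis .
qed

text \<open>As 0 * \<infinity> = 0, a finite product alone would allow an infinite factor. But if
  one factor were 0, a Hoelder bound would make the integral of exp f or exp (- f) over
  \<open>S\<close> vanish, against the positive measure of \<open>S\<close>.\<close>

lemma exp_norms_finite: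
  assumes f [measurable]: "f \<in> borel_measurable M" and pos: "0 < measure M S"
    and fin: "exp_norm f S * exp_assoc f S < \<infinity>"
  shows "exp_norm f S < \<infinity>" "exp_assoc f S < \<infinity>"
proof -
  have int_pos: "(\<integral>\<^sup>+ \<tau>. ennreal (exp (h \<tau>)) * indicator S \<tau> \<partial>M) \<noteq> 0"
    if [measurable]: "h \<in> borel_measurable M" for h
  proof
    assume "(\<integral>\<^sup>+ \<tau>. ennreal (exp (h \<tau>)) * indicator S \<tau> \<partial>M) = 0"
    then have "AE \<tau> in M. ennreal (exp (h \<tau>)) * indicator S \<tau> = 0"
      by (subst (asm) nn_integral_0_iff_AE) auto
    then have "AE \<tau> in M. \<tau> \<notin> S" by eventually_elim (auto simp: indicator_def ennreal_eq_0_iff)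
    then have "emeasure M S = 0" 
      using S sets.sets_into_space[OF S] by (subst (asm) AE_iff_measurable[of S]) auto
    then show False using pos by (simp add: emeasure_eq_measure)
  qed
  have "exp_assoc f S \<noteq> 0"
    using nn_integral_exp_le_exp_assoc[OF f] int_pos[of "\<lambda>\<tau>. - f \<tau>"] by auto
  then show norm_fin: "exp_norm f S < \<infinity>"
    using fin by (auto simp: ennreal_mult_less_top less_top)
  then have "exp_norm f S \<noteq> 0"
    using nn_integral_exp_le_exp_norm[OF f] int_pos[of f] by auto
  then show "exp_assoc f S < \<infinity>"
    using fin by (auto simp: ennreal_mult_less_top less_top)
qed

end

end

section \<open>Mean oscillation of the logarithm of a weight\<close>

locale carleson_weight = carleson_point +
  fixes L :: "complex \<Rightarrow> real" and \<kappa> D :: real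
  assumes L_measurable [measurable]: "L \<in> borel_measurable M"
    and D_pos: "0 < D"
    and muckenhoupt: "\<And>R. 0 < R \<Longrightarrow>
      exp_norm (\<lambda>\<tau>. L \<tau> + \<kappa> * ln (cmod (\<tau> - t))) (portion M t R) *
      exp_assoc (\<lambda>\<tau>. L \<tau> + \<kappa> * ln (cmod (\<tau> - t))) (portion M t R) \<le> ennreal (D * R)"
begin

text \<open>In the application \<open>L\<close> is the logarithm of v and \<open>U\<close> that of
  u.\<close>

definition U :: "complex \<Rightarrow> real" where
  "U \<tau> = L \<tau> + \<kappa> * ln (cmod (\<tau> - t))"

lemma U_measurable [measurable]: "U \<in> borel_measurable M"
  unfolding U_def by measurable

lemma exp_norm_U_mult_exp_assoc_U_le:
  assumes "0 < R" "S \<subseteq> portion M t R"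
  shows "exp_norm U S * exp_assoc U S \<le> ennreal (D * R)"
proof -
  have "exp_norm U S * exp_assoc U S \<le> exp_norm U (portion M t R) * exp_assoc U (portion M t R)"
    using assms by (intro mult_mono exp_norm_mono_set exp_assoc_mono_set) auto
  then show ?thesis using muckenhoupt[OF assms(1)] by (simp add: U_def[abs_def])
qed

text \<open>The products of the mean values of \<open>exp U\<close> and \<open>exp (- U)\<close> are bounded, an
  \<open>A\<^sub>2\<close> condition, and hence \<open>U\<close> has bounded mean oscillation at \<open>t\<close>.\<close>
lemma U_oscillation:
  assumes R: "0 < R" "R \<le> max_dist M t + 1"
  shows "\<exists>c. (\<integral>\<^sup>+ \<tau>. ennreal \<bar>U \<tau> - c\<bar> * indicator (portion M t R) \<tau> \<partial>M)
      \<le> ennreal (measure M (portion M t R) + cn * ca * D * R\<^sup>2 / measure M (portion M t R))"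
proof -
  let ?S = "portion M t R" and ?m = "measure M (portion M t R)"
  define I1 I2 where "I1 = (\<integral>\<^sup>+ \<tau>. ennreal (exp (U \<tau>)) * indicator ?S \<tau> \<partial>M)"
    and "I2 = (\<integral>\<^sup>+ \<tau>. ennreal (exp (- U \<tau>)) * indicator ?S \<tau> \<partial>M)"
  have m: "0 < ?m" using R(1) by (rule portion_pos)
  note prod = exp_norm_U_mult_exp_assoc_U_le[OF R(1) order_refl]
  have "exp_norm U ?S * exp_assoc U ?S < \<infinity>" using prod by (rule le_less_trans) simp
  from exp_norms_finite[OF portion_sets order_refl R U_measurable m this]
  have fin: "exp_norm U ?S < \<infinity>" "exp_assoc U ?S < \<infinity>" .
  have I: "I1 \<le> exp_norm U ?S * ennreal (ca * R powr (1 - 1 / p t))"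
    "I2 \<le> ennreal (cn * R powr (1 / p t)) * exp_assoc U ?S"
    unfolding I1_def I2_def
    using nn_integral_exp_le_exp_norm[OF portion_sets order_refl R U_measurable fin(1)]
      nn_integral_exp_le_exp_assoc[OF portion_sets order_refl R U_measurable fin(2)] by auto
  have "I1 * I2 \<le> (exp_norm U ?S * ennreal (ca * R powr (1 - 1 / p t))) * (ennreal (cn * R powr (1 / p t)) * exp_assoc U ?S)"
    by (intro mult_mono I) auto
  also have "\<dots> = ennreal ((ca * R powr (1 - 1 / p t)) * (cn * R powr (1 / p t))) * (exp_norm U ?S * exp_assoc U ?S)"
    using cn_pos ca_pos by (simp add: ennreal_mult ac_simps)
  also have "(ca * R powr (1 - 1 / p t)) * (cn * R powr (1 / p t)) = cn * ca * R"
    using R by (simp add: powr_diff)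
  also have "ennreal (cn * ca * R) * (exp_norm U ?S * exp_assoc U ?S) \<le> ennreal (cn * ca * R) * ennreal (D * R)"
    by (intro mult_left_mono prod) auto
  also have "\<dots> = ennreal (cn * ca * D * R\<^sup>2)"
    using cn_pos ca_pos D_pos R by (simp add: ennreal_mult[symmetric] power2_eq_square ac_simps)
  finally have I12: "I1 * I2 \<le> ennreal (cn * ca * D * R\<^sup>2)" .
  have I_fin: "I1 < \<infinity>" "I2 < \<infinity>"
    using I fin by (auto intro: le_less_trans simp: ennreal_mult_less_top)
  have I_lower: "I1 \<noteq> 0"
  proof
    assume "I1 = 0"
    then have "AE \<tau> in M. ennreal (exp (U \<tau>)) * indicator ?S \<tau> = 0"
      unfolding I1_def by (subst (asm) nn_integral_0_iff_AE) auto
    then have "AE \<tau> in M. \<tau> \<notin> ?S" by eventually_elim (auto simp: indicator_def ennreal_eq_0_iff)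
    then have "emeasure M ?S = 0"
      using portion_sets sets.sets_into_space[OF portion_sets] by (subst (asm) AE_iff_measurable[of ?S]) auto
    then show False using m by (simp add: emeasure_eq_measure)
  qed
  obtain i1 i2 where i: "I1 = ennreal i1" "I2 = ennreal i2" "0 \<le> i1" "0 \<le> i2"
    using I_fin by (cases I1; cases I2) auto
  have i1: "0 < i1" using i I_lower by (auto simp: less_le)
  have i12: "i1 * i2 \<le> cn * ca * D * R\<^sup>2"
    using I12 i cn_pos ca_pos D_pos by (simp add: ennreal_mult[symmetric] ennreal_le_iff)
  \<comment> \<open>\<open>a\<close> is the mean of \<open>exp U\<close>: the first term of the
    estimate then integrates to the measure of the portion, and the second to \<open>I1 * I2\<close>
    divided by it.\<close>
  define a where "a = i1 / ?m"
  have a: "0 < a" using i1 m by (simp add: a_def)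
  have "(\<integral>\<^sup>+ \<tau>. ennreal \<bar>U \<tau> - ln a\<bar> * indicator ?S \<tau> \<partial>M)
      \<le> (\<integral>\<^sup>+ \<tau>. ennreal (1 / a) * (ennreal (exp (U \<tau>)) * indicator ?S \<tau>)
            + ennreal a * (ennreal (exp (- U \<tau>)) * indicator ?S \<tau>) \<partial>M)"
  proof (rule nn_integral_mono)
    fix \<tau>
    have "ennreal \<bar>U \<tau> - ln a\<bar> \<le> ennreal (1 / a * exp (U \<tau>) + a * exp (- U \<tau>))"
      using abs_diff_ln_le[OF a, of "U \<tau>"] by (intro ennreal_leI) simp
    also have "\<dots> = ennreal (1 / a) * ennreal (exp (U \<tau>)) + ennreal a * ennreal (exp (- U \<tau>))"
      using a by (simp only: ennreal_plus ennreal_mult'' exp_ge_zero mult_nonneg_nonneg less_imp_le divide_nonneg_pos zero_le_one)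
    finally show "ennreal \<bar>U \<tau> - ln a\<bar> * indicator ?S \<tau> \<le> ennreal (1 / a) * (ennreal (exp (U \<tau>)) * indicator ?S \<tau>)
            + ennreal a * (ennreal (exp (- U \<tau>)) * indicator ?S \<tau>)"
      by (simp add: indicator_def)
  qed
  also have "\<dots> = ennreal (1 / a) * I1 + ennreal a * I2"
    unfolding I1_def I2_def by (subst nn_integral_add) (auto simp: nn_integral_cmult)
  also have "\<dots> = ennreal (i1 / a + a * i2)"
    using a i by (simp add: ennreal_mult[symmetric] flip: ennreal_plus)
  also have "i1 / a = ?m" using i1 m by (simp add: a_def)
  also have "a * i2 \<le> cn * ca * D * R\<^sup>2 / ?m" using i12 m by (simp add: a_def divide_right_mono)
  finally show ?thesis by (auto intro!: exI[of _ "ln a"] simp: ennreal_leI)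
qed

text \<open>Removing the logarithmic term adds its own oscillation about \<open>ln R\<close> and
  moves the centre by \<open>\<kappa> * ln R\<close>. The measure of the portion stays in the bound
  because \<open>portion_ge\<close> stops at \<open>max_dist M t\<close>.\<close>

lemma L_oscillation_aux:
  assumes R: "0 < R" "R \<le> max_dist M t + 1"
  shows "\<exists>c. (\<integral>\<^sup>+ \<tau>. ennreal \<bar>L \<tau> - c\<bar> * indicator (portion M t R) \<tau> \<partial>M)
      \<le> ennreal (measure M (portion M t R) + cn * ca * D * R\<^sup>2 / measure M (portion M t R)
          + \<bar>\<kappa>\<bar> * (2 * ln 2 * C * R))"
proof -
  let ?S = "portion M t R" and ?m = "measure M (portion M t R)"
  obtain c where c: "(\<integral>\<^sup>+ \<tau>. ennreal \<bar>U \<tau> - c\<bar> * indicator ?S \<tau> \<partial>M) \<le> ennreal (?m + cn * ca * D * R\<^sup>2 / ?m)"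
    using U_oscillation[OF R] by blast
  have "(\<integral>\<^sup>+ \<tau>. ennreal \<bar>L \<tau> - (c - \<kappa> * ln R)\<bar> * indicator ?S \<tau> \<partial>M)
      \<le> (\<integral>\<^sup>+ \<tau>. ennreal \<bar>U \<tau> - c\<bar> * indicator ?S \<tau>
            + ennreal \<bar>\<kappa>\<bar> * (ennreal \<bar>ln (cmod (\<tau> - t)) - ln R\<bar> * indicator ?S \<tau>) \<partial>M)"
  proof (rule nn_integral_mono)
    fix \<tau>
    have "L \<tau> - (c - \<kappa> * ln R) = (U \<tau> - c) - \<kappa> * (ln (cmod (\<tau> - t)) - ln R)"
      by (simp add: U_def algebra_simps)
    then have "\<bar>L \<tau> - (c - \<kappa> * ln R)\<bar> \<le> \<bar>U \<tau> - c\<bar> + \<bar>\<kappa>\<bar> * \<bar>ln (cmod (\<tau> - t)) - ln R\<bar>"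
      by (metis abs_mult abs_triangle_ineq4)
    then have "ennreal \<bar>L \<tau> - (c - \<kappa> * ln R)\<bar> \<le> ennreal \<bar>U \<tau> - c\<bar> + ennreal \<bar>\<kappa>\<bar> * ennreal \<bar>ln (cmod (\<tau> - t)) - ln R\<bar>"
      by (simp add: ennreal_leI ennreal_mult[symmetric] flip: ennreal_plus)
    then show "ennreal \<bar>L \<tau> - (c - \<kappa> * ln R)\<bar> * indicator ?S \<tau> \<le> ennreal \<bar>U \<tau> - c\<bar> * indicator ?S \<tau>
            + ennreal \<bar>\<kappa>\<bar> * (ennreal \<bar>ln (cmod (\<tau> - t)) - ln R\<bar> * indicator ?S \<tau>)"
      by (simp add: indicator_def)
  qed
  also have "\<dots> = (\<integral>\<^sup>+ \<tau>. ennreal \<bar>U \<tau> - c\<bar> * indicator ?S \<tau> \<partial>M)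
      + ennreal \<bar>\<kappa>\<bar> * (\<integral>\<^sup>+ \<tau>. ennreal \<bar>ln (cmod (\<tau> - t)) - ln R\<bar> * indicator ?S \<tau> \<partial>M)"
    by (subst nn_integral_add) (auto simp: nn_integral_cmult)
  also have "\<dots> \<le> ennreal (?m + cn * ca * D * R\<^sup>2 / ?m) + ennreal \<bar>\<kappa>\<bar> * ennreal (2 * ln 2 * C * R)"
    by (intro add_mono mult_left_mono c nn_integral_ln_dist_le R) auto
  also have "\<dots> = ennreal (?m + cn * ca * D * R\<^sup>2 / ?m + \<bar>\<kappa>\<bar> * (2 * ln 2 * C * R))"
    using cn_pos ca_pos D_pos C_pos R by (simp add: ennreal_mult[symmetric] flip: ennreal_plus)
  finally show ?thesis by blast
qed

lemma L_integrable: "set_integrable M (portion M t R) L"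
proof -
  \<comment> \<open>Beyond \<open>max_dist M t\<close> portions no longer grow, so the radius can be
    capped where the oscillation bound still holds.\<close>
  define r where "r = min R (max_dist M t + 1)"
  have "portion M t R = portion M t r"
  proof (cases "R \<le> max_dist M t + 1")
    case False
    then have "cmod (\<tau> - t) < r" "cmod (\<tau> - t) < R" if "\<tau> \<in> space M" for \<tau>
      using le_max_dist[OF that] by (simp_all add: r_def)
    then show ?thesis unfolding portion_def by blast
  qed (simp add: r_def)
  moreover have "set_integrable M (portion M t r) L"
  proof (cases "0 < r")
    case True
    have r: "r \<le> max_dist M t + 1" by (simp add: r_def)
    obtain c where "(\<integral>\<^sup>+ \<tau>. ennreal \<bar>L \<tau> - c\<bar> * indicator (portion M t r) \<tau> \<partial>M)
      \<le> ennreal (measure M (portion M t r) + cn * ca * D * r\<^sup>2 / measure M (portion M t r)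
          + \<bar>\<kappa>\<bar> * (2 * ln 2 * C * r))"
      using L_oscillation_aux[OF True r] by blast
    then show ?thesis
      by (rule mean_sub_const_le(1)[OF finite_measure_axioms L_measurable portion_sets order_refl portion_pos[OF True]])
        (use cn_pos ca_pos D_pos C_pos True in auto)
  next
    case False
    then have "portion M t r = {}" 
      unfolding portion_def using norm_ge_zero order.strict_trans1 by blast
    then show ?thesis by (simp add: set_integrable_def)
  qed
  ultimately show ?thesis by simp
qed

text \<open>The three summands stem from the measure of the portion, from R^2 divided by that
  measure (at least R / 2), and from the logarithm of the distance.\<close>

definition "osc = C + 2 * cn * ca * D + \<bar>\<kappa>\<bar> * (2 * ln 2 * C)"

lemma osc_pos: "0 < osc"
  unfolding osc_def using cn_pos ca_pos D_pos C_pos by (intro add_pos_nonneg add_pos_pos) auto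

lemma L_oscillation:
  assumes R: "0 < R" "R \<le> max_dist M t"
  shows "\<exists>c. (\<integral>\<^sup>+ \<tau>. ennreal \<bar>L \<tau> - c\<bar> * indicator (portion M t R) \<tau> \<partial>M) \<le> ennreal (osc * R)"
proof -
  let ?m = "measure M (portion M t R)"
  have "cn * ca * D * R\<^sup>2 / ?m \<le> cn * ca * D * R\<^sup>2 / (R / 2)"
    using portion_ge[OF R] R cn_pos ca_pos D_pos by (intro divide_left_mono) auto
  also have "\<dots> = 2 * cn * ca * D * R" using R by (simp add: power2_eq_square)
  finally have "?m + cn * ca * D * R\<^sup>2 / ?m + \<bar>\<kappa>\<bar> * (2 * ln 2 * C * R) \<le> osc * R"
    using portion_le[OF R(1)] by (simp add: osc_def algebra_simps)
  moreover obtain c where "(\<integral>\<^sup>+ \<tau>. ennreal \<bar>L \<tau> - c\<bar> * indicator (portion M t R) \<tau> \<partial>M)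
      \<le> ennreal (?m + cn * ca * D * R\<^sup>2 / ?m + \<bar>\<kappa>\<bar> * (2 * ln 2 * C * R))"
    using L_oscillation_aux[of R] R by auto
  ultimately show ?thesis by (meson ennreal_leI order.trans)
qed

text \<open>Both means lie within \<open>osc / k\<close> of the one constant supplied by
  \<open>L_oscillation\<close>.\<close>

lemma mean_diff_le:
  assumes R: "0 < R" "R \<le> max_dist M t" and k: "0 < k"
    and S: "S \<in> sets M" "S \<subseteq> portion M t R" "k * R \<le> measure M S"
    and T: "T \<in> sets M" "T \<subseteq> portion M t R" "k * R \<le> measure M T"
  shows "\<bar>(LINT \<tau>:S|M. L \<tau>) / measure M S - (LINT \<tau>:T|M. L \<tau>) / measure M T\<bar> \<le> 2 * osc / k"
proof -
  obtain c where c: "(\<integral>\<^sup>+ \<tau>. ennreal \<bar>L \<tau> - c\<bar> * indicator (portion M t R) \<tau> \<partial>M) \<le> ennreal (osc * R)"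
    using L_oscillation[OF R] by blast
  have *: "\<bar>(LINT \<tau>:S|M. L \<tau>) / measure M S - c\<bar> \<le> osc / k"
    if S: "S \<in> sets M" "S \<subseteq> portion M t R" "k * R \<le> measure M S" for S
  proof -
    have kR: "0 < k * R" using k R by simp
    then have pos: "0 < measure M S" using S by linarith
    have "\<bar>(LINT \<tau>:S|M. L \<tau>) / measure M S - c\<bar> \<le> osc * R / measure M S"
      by (rule mean_sub_const_le(2)[OF finite_measure_axioms L_measurable S(1,2) pos c])
        (use osc_pos R in auto)
    also have "\<dots> \<le> osc * R / (k * R)"
      using S(3) kR osc_pos R by (intro divide_left_mono) auto
    finally show ?thesis using R by simp
  qed
  show ?thesis using *[OF S] *[OF T] by (simp add: field_simps)
qed

end

section \<open>Two-sided bounds for the norms over annuli\<close>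

context carleson_weight
begin

abbreviation mean_log :: "real \<Rightarrow> real" where
  "mean_log R \<equiv> mean_value M t L R"

lemma U_L_bound:
  assumes "0 < R" "\<tau> \<in> annulus M t R"
  shows "\<bar>U \<tau> - L \<tau> - \<kappa> * ln R\<bar> \<le> \<bar>\<kappa>\<bar> * ln 2"
proof -
  have "R / 2 \<le> cmod (\<tau> - t)" "cmod (\<tau> - t) < R"
    using assms(2) by (auto simp: annulus_def portion_def)
  then have "ln (R / 2) \<le> ln (cmod (\<tau> - t))" "ln (cmod (\<tau> - t)) \<le> ln R"
    using assms(1) by (subst ln_le_cancel_iff; linarith)+
  then have "\<bar>ln (cmod (\<tau> - t)) - ln R\<bar> \<le> ln 2" using assms(1) by (simp add: ln_div)
  then have "\<bar>\<kappa>\<bar> * \<bar>ln (cmod (\<tau> - t)) - ln R\<bar> \<le> \<bar>\<kappa>\<bar> * ln 2" by (intro mult_left_mono) auto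
  then show ?thesis by (simp add: U_def abs_mult[symmetric] right_diff_distrib)
qed

text \<open>Replacing \<open>U\<close> by \<open>L\<close> multiplies the two norms by reciprocal
  powers of \<open>R\<close>, which cancel; each norm loses at most 2^|\<kappa>| besides.\<close>

lemma exp_norm_L_mult_exp_assoc_L_le:
  assumes R: "0 < R"
  shows "exp_norm L (annulus M t R) * exp_assoc L (annulus M t R) \<le> ennreal (exp (2 * \<bar>\<kappa>\<bar> * ln 2) * D * R)"
proof -
  let ?S = "annulus M t R" and ?k = "\<bar>\<kappa>\<bar> * ln 2"
  have "exp_norm L ?S * exp_assoc L ?S
      \<le> (ennreal (exp (?k - \<kappa> * ln R)) * exp_norm U ?S) * (ennreal (exp (?k + \<kappa> * ln R)) * exp_assoc U ?S)"
  proof (intro mult_mono)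
    show "exp_norm L ?S \<le> ennreal (exp (?k - \<kappa> * ln R)) * exp_norm U ?S"
    proof (rule exp_norm_scale)
      fix \<tau> assume "\<tau> \<in> ?S"
      from U_L_bound[OF R this] show "L \<tau> \<le> U \<tau> + (?k - \<kappa> * ln R)" by linarith
    qed
    show "exp_assoc L ?S \<le> ennreal (exp (?k + \<kappa> * ln R)) * exp_assoc U ?S"
    proof (rule exp_assoc_scale)
      fix \<tau> assume "\<tau> \<in> ?S"
      from U_L_bound[OF R this] show "U \<tau> \<le> L \<tau> + (?k + \<kappa> * ln R)" by linarith
    qed measurable
  qed auto
  also have "\<dots> = ennreal (exp (?k - \<kappa> * ln R) * exp (?k + \<kappa> * ln R)) * (exp_norm U ?S * exp_assoc U ?S)"
    by (simp add: ennreal_mult ac_simps)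
  also have "exp (?k - \<kappa> * ln R) * exp (?k + \<kappa> * ln R) = exp (2 * \<bar>\<kappa>\<bar> * ln 2)"
    by (simp flip: exp_add)
  also have "ennreal (exp (2 * \<bar>\<kappa>\<bar> * ln 2)) * (exp_norm U ?S * exp_assoc U ?S)
      \<le> ennreal (exp (2 * \<bar>\<kappa>\<bar> * ln 2)) * ennreal (D * R)"
    using R by (intro mult_left_mono exp_norm_U_mult_exp_assoc_U_le annulus_subset) auto
  also have "\<dots> = ennreal (exp (2 * \<bar>\<kappa>\<bar> * ln 2) * D * R)"
    using D_pos R by (simp add: ennreal_mult[symmetric] mult.assoc)
  finally show ?thesis .
qed

lemma annulus_norms:
  assumes R: "0 < R" "R \<le> max_dist M t"
  obtains n a where "exp_norm L (annulus M t R) = ennreal n" "exp_assoc L (annulus M t R) = ennreal a"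
    "0 < n" "0 < a" "n * a \<le> exp (2 * \<bar>\<kappa>\<bar> * ln 2) * D * R"
    "exp (mean_log R) * R powr (1 / p t) \<le> 2 * ca * exp (4 * osc) * n"
    "exp (- mean_log R) * R powr (1 - 1 / p t) \<le> 2 * cn * exp (4 * osc) * a"
proof -
  let ?S = "annulus M t R"
  define c where "c = (LINT \<tau>:?S|M. L \<tau>) / measure M ?S"
  have R': "R \<le> max_dist M t + 1" using R by simp
  have S_ge: "R / 2 \<le> measure M ?S" by (rule annulus_ge[OF R])
  have S_pos: "0 < measure M ?S" using S_ge R by linarith
  have prod: "exp_norm L ?S * exp_assoc L ?S \<le> ennreal (exp (2 * \<bar>\<kappa>\<bar> * ln 2) * D * R)"
    by (rule exp_norm_L_mult_exp_assoc_L_le[OF R(1)])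
  have "exp_norm L ?S * exp_assoc L ?S < \<infinity>" using prod by (rule le_less_trans) simp
  from exp_norms_finite[OF annulus_sets annulus_subset R(1) R' L_measurable S_pos this]
  have fin: "exp_norm L ?S < \<infinity>" "exp_assoc L ?S < \<infinity>" .
  then obtain n a where na: "exp_norm L ?S = ennreal n" "exp_assoc L ?S = ennreal a" "0 \<le> n" "0 \<le> a"
    by (cases "exp_norm L ?S"; cases "exp_assoc L ?S") auto
  have int: "set_integrable M ?S L"
    by (rule set_integrable_subset[OF L_integrable annulus_sets annulus_subset])
  \<comment> \<open>Annulus and portion both have measure at least \<open>R / 2\<close>, so
    \<open>mean_diff_le\<close> applies with \<open>k = 1 / 2\<close> and gives
    \<open>4 * osc\<close>.\<close>
  have c_mean: "\<bar>c - mean_log R\<bar> \<le> 4 * osc"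
    using mean_diff_le[OF R, of "1 / 2" ?S "portion M t R"] S_ge portion_ge[OF R] annulus_subset
    by (simp add: c_def mean_value_def annulus_sets portion_sets)
  have "ennreal (measure M ?S * exp c) \<le> (\<integral>\<^sup>+ \<tau>. ennreal (exp (L \<tau>)) * indicator ?S \<tau> \<partial>M)"
    unfolding c_def by (rule exp_mean_le_nn_integral[OF finite_measure_axioms annulus_sets S_pos int])
  also have "\<dots> \<le> ennreal n * ennreal (ca * R powr (1 - 1 / p t))"
    using nn_integral_exp_le_exp_norm[OF annulus_sets annulus_subset R(1) R' L_measurable fin(1)] na by simp
  finally have "measure M ?S * exp c \<le> n * (ca * R powr (1 - 1 / p t))"
    using na ca_pos by (simp add: ennreal_mult[symmetric] ennreal_le_iff)
  moreover have "R / 2 * exp (mean_log R - 4 * osc) \<le> measure M ?S * exp c"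
    using S_ge c_mean R by (intro mult_mono) auto
  ultimately have "R / 2 * exp (mean_log R - 4 * osc) \<le> n * (ca * R powr (1 - 1 / p t))" by linarith
  then have n_ge: "exp (mean_log R) * R powr (1 / p t) \<le> 2 * ca * exp (4 * osc) * n"
    using R by (simp add: exp_diff powr_diff field_simps)
  have mean_uminus: "(LINT \<tau>:?S|M. - L \<tau>) / measure M ?S = - c"
    using set_integral_uminus[OF int] by (simp add: c_def)
  have "ennreal (measure M ?S * exp (- c)) \<le> (\<integral>\<^sup>+ \<tau>. ennreal (exp (- L \<tau>)) * indicator ?S \<tau> \<partial>M)"
    unfolding mean_uminus[symmetric]
    using int by (intro exp_mean_le_nn_integral[OF finite_measure_axioms annulus_sets S_pos])
      (simp add: set_integrable_def)
  also have "\<dots> \<le> ennreal (cn * R powr (1 / p t)) * ennreal a"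
    using nn_integral_exp_le_exp_assoc[OF annulus_sets annulus_subset R(1) R' L_measurable fin(2)] na by simp
  finally have "measure M ?S * exp (- c) \<le> cn * R powr (1 / p t) * a"
    using na cn_pos by (simp add: ennreal_mult[symmetric] ennreal_le_iff)
  moreover have "R / 2 * exp (- mean_log R - 4 * osc) \<le> measure M ?S * exp (- c)"
    using S_ge c_mean R by (intro mult_mono) auto
  ultimately have "R / 2 * exp (- mean_log R - 4 * osc) \<le> cn * R powr (1 / p t) * a" by linarith
  then have a_ge: "exp (- mean_log R) * R powr (1 - 1 / p t) \<le> 2 * cn * exp (4 * osc) * a"
    using R by (simp add: exp_diff powr_diff field_simps)
  have "0 < 2 * ca * exp (4 * osc) * n"
    by (rule less_le_trans[OF _ n_ge]) (use R in simp)
  then have n_pos: "0 < n" using na(3) by (cases "n = 0") auto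
  have "0 < 2 * cn * exp (4 * osc) * a"
    by (rule less_le_trans[OF _ a_ge]) (use R in simp)
  then have a_pos: "0 < a" using na(4) by (cases "a = 0") auto
  have "n * a \<le> exp (2 * \<bar>\<kappa>\<bar> * ln 2) * D * R"
    using prod na D_pos R by (simp add: ennreal_mult[symmetric] ennreal_le_iff)
  then show ?thesis using that na n_pos a_pos n_ge a_ge by blast
qed

text \<open>The first maximum serves the lower bounds of both norms, the second their product; it is
  kept at least 1 so that \<open>cmp\<close> also dominates the first maximum alone.\<close>

definition "cmp = max (2 * ca * exp (4 * osc)) (2 * cn * exp (4 * osc)) * max 1 (exp (2 * \<bar>\<kappa>\<bar> * ln 2) * D)"

lemma cmp_pos: "0 < cmp"
  unfolding cmp_def using ca_pos by (intro mult_pos_pos) (auto simp: less_max_iff_disj)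

lemma annulus_norms_comparable:
  assumes R: "0 < R" "R \<le> max_dist M t"
  obtains n a where "exp_norm L (annulus M t R) = ennreal n" "exp_assoc L (annulus M t R) = ennreal a"
    "0 < n" "0 < a"
    "exp (mean_log R) * R powr (1 / p t) \<le> cmp * n" "n \<le> cmp * (exp (mean_log R) * R powr (1 / p t))"
    "exp (- mean_log R) * R powr (1 - 1 / p t) \<le> cmp * a" "a \<le> cmp * (exp (- mean_log R) * R powr (1 - 1 / p t))"
proof -
  define E where "E = exp (mean_log R) * R powr (1 / p t)"
  define F where "F = exp (- mean_log R) * R powr (1 - 1 / p t)"
  define k where "k = max (2 * ca * exp (4 * osc)) (2 * cn * exp (4 * osc))"
  define j where "j = max 1 (exp (2 * \<bar>\<kappa>\<bar> * ln 2) * D)"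
  have EF: "0 < E" "0 < F" "E * F = R"
    using R by (simp_all add: E_def F_def powr_diff exp_minus field_simps)
  have k: "0 < k" "cmp = k * j" and j: "1 \<le> j"
    using ca_pos by (auto simp: k_def j_def cmp_def less_max_iff_disj)
  obtain n a where na: "exp_norm L (annulus M t R) = ennreal n" "exp_assoc L (annulus M t R) = ennreal a"
    "0 < n" "0 < a" and prod: "n * a \<le> exp (2 * \<bar>\<kappa>\<bar> * ln 2) * D * R"
    and n: "E \<le> 2 * ca * exp (4 * osc) * n" and a: "F \<le> 2 * cn * exp (4 * osc) * a"
    using annulus_norms[OF R] unfolding E_def F_def by blast
  have "2 * ca * exp (4 * osc) * n \<le> k * n" "2 * cn * exp (4 * osc) * a \<le> k * a"
    using na by (auto simp: k_def intro!: mult_right_mono)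
  then have E_le: "E \<le> k * n" and F_le: "F \<le> k * a" using n a by linarith+
  have "exp (2 * \<bar>\<kappa>\<bar> * ln 2) * D * R \<le> j * R" using R by (intro mult_right_mono) (auto simp: j_def)
  then have prod': "n * a \<le> j * (E * F)" using prod EF by simp
  \<comment> \<open>An upper bound for one norm is the bound of the product divided by the lower
    bound for the other; \<open>x\<close> and \<open>y\<close> stand for the two norms in either
    order.\<close>
  have up: "x \<le> k * j * X" if "X * Y = E * F" "x * y \<le> j * (E * F)" "Y \<le> k * y" "0 < x" "0 < Y" for x y X Y
  proof -
    have "x * Y \<le> x * (k * y)" using that by (intro mult_left_mono) auto
    also have "\<dots> = k * (x * y)" by simp
    also have "\<dots> \<le> k * (j * (E * F))" using that k by (intro mult_left_mono) auto
    also have "\<dots> = k * j * X * Y" using that(1) by (simp add: mult.assoc)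
    finally show ?thesis using that by simp
  qed
  have kj: "k \<le> cmp" using k j by simp
  show ?thesis
  proof (rule that[OF na], unfold E_def[symmetric] F_def[symmetric])
    show "E \<le> cmp * n" using E_le kj na(3) by (meson mult_right_mono less_imp_le order.trans)
    show "F \<le> cmp * a" using F_le kj na(4) by (meson mult_right_mono less_imp_le order.trans)
    show "n \<le> cmp * E" using up[of E F n a] prod' F_le na EF k by simp
    show "a \<le> cmp * F" using up[of F E a n] prod' E_le na EF k by (simp add: mult.commute)
  qed
qed

text \<open>Hoelder's inequality for exp L * exp (- L) = 1. It makes the middle factor in
  \<open>G_fun_trans\<close> at least 1.\<close>

lemma measure_annulus_le_norms:
  assumes R: "0 < R" "R \<le> max_dist M t"
  shows "emeasure M (annulus M t R) \<le> exp_norm L (annulus M t R) * exp_assoc L (annulus M t R)"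
proof -
  let ?S = "annulus M t R"
  obtain n a where na: "exp_norm L ?S = ennreal n" "exp_assoc L ?S = ennreal a"
    using annulus_norms[OF R] by blast
  have "emeasure M ?S = (\<integral>\<^sup>+ \<tau>. (ennreal (exp (L \<tau>)) * indicator ?S \<tau>) * (ennreal (exp (- L \<tau>)) * indicator ?S \<tau>) \<partial>M)"
  proof -
    have "(ennreal (exp (L \<tau>)) * indicator ?S \<tau>) * (ennreal (exp (- L \<tau>)) * indicator ?S \<tau>) = indicator ?S \<tau>" for \<tau>
      by (simp add: indicator_def ennreal_mult[symmetric] exp_add[symmetric])
    then show ?thesis by simp
  qed
  also have "\<dots> \<le> exp_norm L ?S * exp_assoc L ?S"
    unfolding exp_norm_def exp_assoc_def
  proof (rule nakano_holder)
    show "nakano_norm M p (\<lambda>\<tau>. ennreal (exp (L \<tau>)) * indicator ?S \<tau>) < \<infinity>"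
      using na(1) by (simp add: exp_norm_def)
    show "associate_norm M p (\<lambda>\<tau>. ennreal (exp (- L \<tau>)) * indicator ?S \<tau>) < \<infinity>"
      using na(2) by (simp add: exp_assoc_def)
  qed (use p_nonneg in \<open>auto simp: indicator_def\<close>)
  finally show ?thesis .
qed

end

section \<open>The supremum behind Q_t and V_t\<close>

definition ratio_sup :: "real \<Rightarrow> (real \<Rightarrow> real \<Rightarrow> ennreal) \<Rightarrow> real \<Rightarrow> ennreal" where
  "ratio_sup d F x =
     (if x \<le> 1 then SUP R\<in>{0<..d}. F (x * R) R else SUP R\<in>{0<..d}. F R (inverse x * R))"

text \<open>Both branches range over pairs of radii in (0,d] with quotient \<open>x\<close>; the
  case distinction only makes the larger radius the parameter. This lemma and
  \<open>ratio_sup_upper\<close> remove it.\<close>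

lemma ratio_sup_le:
  assumes "0 < x"
    and "\<And>R. 0 < R \<Longrightarrow> R \<le> d \<Longrightarrow> x * R \<le> d \<Longrightarrow> F (x * R) R \<le> c"
  shows "ratio_sup d F x \<le> c"
proof (cases "x \<le> 1")
  case True
  have "F (x * R) R \<le> c" if R: "R \<in> {0<..d}" for R
  proof -
    have "x * R \<le> R" using R assms(1) True by (intro mult_left_le_one_le) auto
    then have "x * R \<le> d" using R by (auto simp only: greaterThanAtMost_iff elim: order.trans)
    then show ?thesis using R by (intro assms(2)) auto
  qed
  then show ?thesis using True by (auto simp: ratio_sup_def intro: SUP_least)
next
  case False
  have "F R (inverse x * R) \<le> c" if R: "R \<in> {0<..d}" for R
  proof -
    have "inverse x * R \<le> R" using R False by (simp add: field_simps)
    then have "inverse x * R \<le> d" using R by (auto simp only: greaterThanAtMost_iff elim: order.trans)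
    then have "F (x * (inverse x * R)) (inverse x * R) \<le> c"
      using R assms(1) False by (intro assms(2)) (auto simp: mult.assoc[symmetric])
    then show ?thesis using assms(1) by (simp add: mult.assoc[symmetric])
  qed
  then show ?thesis using False by (auto simp: ratio_sup_def intro: SUP_least)
qed

lemma ratio_sup_upper:
  assumes "0 < x" "0 < R" "R \<le> d" "x * R \<le> d"
  shows "F (x * R) R \<le> ratio_sup d F x"
proof (cases "x \<le> 1")
  case True
  then show ?thesis using assms unfolding ratio_sup_def by (auto intro!: SUP_upper)
next
  case False
  have "F (x * R) (inverse x * (x * R)) \<le> (SUP R\<in>{0<..d}. F R (inverse x * R))"
    using assms by (intro SUP_upper) auto
  then show ?thesis using False assms by (simp add: ratio_sup_def mult.assoc[symmetric])
qed

text \<open>Between \<open>x * y * R\<close> and \<open>R\<close> the middle radius is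
  \<open>y * R\<close>, or \<open>x * R\<close> if the former exceeds \<open>d\<close>. They cannot
  both exceed \<open>d\<close>, for then x > 1 and x y R > y R > d.\<close>

lemma ratio_sup_submultiplicative:
  assumes trans: "\<And>R1 R2 R3. R1 \<in> {0<..d} \<Longrightarrow> R2 \<in> {0<..d} \<Longrightarrow> R3 \<in> {0<..d} \<Longrightarrow> F R1 R3 \<le> F R1 R2 * F R2 R3"
  shows "submultiplicative (ratio_sup d F)"
  unfolding submultiplicative_def
proof (intro allI impI)
  fix x y :: real assume xy: "0 < x" "0 < y"
  show "ratio_sup d F (x * y) \<le> ratio_sup d F x * ratio_sup d F y"
  proof (rule ratio_sup_le)
    fix R assume R: "0 < R" "R \<le> d" "x * y * R \<le> d"
    have step: "F (a * (b * R)) R \<le> ratio_sup d F a * ratio_sup d F b"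
      if "0 < a" "0 < b" "b * R \<le> d" "a * (b * R) \<le> d" for a b
      using that R
      by (intro order.trans[OF trans[of "a * (b * R)" "b * R" R]] mult_mono ratio_sup_upper) auto
    show "F (x * y * R) R \<le> ratio_sup d F x * ratio_sup d F y"
    proof (cases "y * R \<le> d")
      case True
      then show ?thesis using step[of x y] xy R by (simp add: mult.assoc)
    next
      case False
      have "x * R \<le> d"
      proof (rule ccontr)
        assume "\<not> x * R \<le> d"
        then have "1 * R < x * R" using R by linarith
        then have "1 < x" using R by simp
        then have "1 * (y * R) < x * (y * R)" using xy R by (intro mult_strict_right_mono) auto
        then show False using False R by (simp add: mult.assoc)
      qed
      then show ?thesis using step[of y x] xy R by (simp add: mult.assoc mult.left_commute mult.commute)
    qed
  qed (use xy in simp)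
qed

lemma Q_fun_eq_ratio_sup: "Q_fun M p t v = ratio_sup (max_dist M t) (G_fun M p t v)"
  by (simp add: fun_eq_iff Q_fun_def ratio_sup_def)

lemma V_fun_eq_ratio_sup: "V_fun M t v = ratio_sup (max_dist M t) (\<lambda>R1 R2. ennreal (H_fun M t v R1 R2))"
  by (simp add: fun_eq_iff V_fun_def ratio_sup_def)

section \<open>Comparison of Q_t with V_t\<close>

locale carleson_ennreal_weight = carleson_weight M t p C B "log_weight v" \<kappa> D
  for M t p C B and v :: "complex \<Rightarrow> ennreal" and \<kappa> D +
  assumes v_eq: "AE \<tau> in M. v \<tau> = ennreal (exp (log_weight v \<tau>))"
begin

abbreviation "L \<equiv> log_weight v"

lemma H_fun_eq: "H_fun M t v R1 R2 = exp (mean_log R1) / exp (mean_log R2)"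
  by (simp add: H_fun_def)

lemma G_fun_eq:
  "G_fun M p t v R1 R2 = exp_norm L (annulus M t R1) * exp_assoc L (annulus M t R2) / emeasure M (annulus M t R2)"
proof -
  have v1: "AE \<tau> in M. v \<tau> * indicator S \<tau> = ennreal (exp (L \<tau>)) * indicator S \<tau>" for S
    using v_eq by eventually_elim simp
  have v2: "AE \<tau> in M. indicator S \<tau> / v \<tau> = ennreal (exp (- L \<tau>)) * indicator S \<tau>" for S
    using v_eq
  proof eventually_elim
    case (elim \<tau>)
    have "indicator S \<tau> / ennreal (exp (L \<tau>)) = ennreal (exp (- L \<tau>)) * indicator S \<tau>"
      by (simp add: divide_ennreal_def inverse_ennreal exp_minus mult.commute)
    then show ?case using elim by simp
  qed
  have "nakano_norm M p (\<lambda>\<tau>. v \<tau> * indicator S \<tau>) = exp_norm L S" for S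
    unfolding exp_norm_def using v1[of S] p_nonneg
    by (intro antisym nakano_norm_mono) (auto elim!: eventually_mono)
  moreover have "associate_norm M p (\<lambda>\<tau>. indicator S \<tau> / v \<tau>) = exp_assoc L S" for S
    unfolding exp_assoc_def using v2[of S]
    by (intro antisym associate_norm_mono) (auto elim!: eventually_mono)
  ultimately show ?thesis by (simp add: G_fun_def)
qed

text \<open>The reference values of the two norms have product \<open>R\<close>, so the bounds for
  the associate norm can be restated with that of the first norm; the comparison then involves one
  expression per radius.\<close>

lemma annulus_real:
  assumes R: "0 < R" "R \<le> max_dist M t"
  obtains n a m where "exp_norm L (annulus M t R) = ennreal n" "exp_assoc L (annulus M t R) = ennreal a"
    "emeasure M (annulus M t R) = ennreal m"
    "0 < n" "0 < a" "0 < m" "m \<le> n * a" "R / 2 \<le> m" "m \<le> C * R"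
    "exp (mean_log R) * R powr (1 / p t) \<le> cmp * n" "n \<le> cmp * (exp (mean_log R) * R powr (1 / p t))"
    "R \<le> cmp * a * (exp (mean_log R) * R powr (1 / p t))"
    "a * (exp (mean_log R) * R powr (1 / p t)) \<le> cmp * R"
proof -
  let ?S = "annulus M t R" and ?E = "exp (mean_log R) * R powr (1 / p t)"
  obtain n a where na: "exp_norm L ?S = ennreal n" "exp_assoc L ?S = ennreal a" "0 < n" "0 < a"
    and b: "?E \<le> cmp * n" "n \<le> cmp * ?E"
    "exp (- mean_log R) * R powr (1 - 1 / p t) \<le> cmp * a" "a \<le> cmp * (exp (- mean_log R) * R powr (1 - 1 / p t))"
    using annulus_norms_comparable[OF R] by blast
  have EF: "exp (- mean_log R) * R powr (1 - 1 / p t) = R / ?E"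
    using R by (simp add: exp_minus powr_diff field_simps)
  have E: "0 < ?E" using R by simp
  have m: "R / 2 \<le> measure M ?S" "measure M ?S \<le> C * R"
    using annulus_ge[OF R] portion_le[OF R(1)] finite_measure_mono[OF annulus_subset portion_sets, of R]
    by linarith+
  show ?thesis
  proof (rule that[of n a "measure M ?S"])
    show "measure M ?S \<le> n * a"
      using measure_annulus_le_norms[OF R] na by (simp add: emeasure_eq_measure ennreal_mult[symmetric] ennreal_le_iff)
    show "0 < measure M ?S" using m R by linarith
    show "R \<le> cmp * a * ?E" using b(3) E unfolding EF by (simp add: divide_le_eq mult.assoc)
    have "a * ?E \<le> (cmp * (R / ?E)) * ?E" using b(4) E unfolding EF by (intro mult_right_mono) auto
    also have "\<dots> = cmp * R" using R by simp
    finally show "a * ?E \<le> cmp * R" .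
  qed (use na b m in \<open>simp_all add: emeasure_eq_measure\<close>)
qed

lemma G_fun_trans:
  assumes "R1 \<in> {0<..max_dist M t}" "R2 \<in> {0<..max_dist M t}" "R3 \<in> {0<..max_dist M t}"
  shows "G_fun M p t v R1 R3 \<le> G_fun M p t v R1 R2 * G_fun M p t v R2 R3"
proof -
  obtain n1 where 1: "exp_norm L (annulus M t R1) = ennreal n1" "0 < n1"
    using annulus_real[of R1] assms by (metis greaterThanAtMost_iff)
  obtain n2 a2 m2 where 2: "exp_norm L (annulus M t R2) = ennreal n2"
    "exp_assoc L (annulus M t R2) = ennreal a2" "emeasure M (annulus M t R2) = ennreal m2"
    "0 < n2" "0 < a2" "0 < m2" "m2 \<le> n2 * a2"
    using annulus_real[of R2] assms by (metis greaterThanAtMost_iff)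
  obtain a3 m3 where 3: "exp_assoc L (annulus M t R3) = ennreal a3" "emeasure M (annulus M t R3) = ennreal m3"
    "0 < a3" "0 < m3"
    using annulus_real[of R3] assms by (metis greaterThanAtMost_iff)
  have "1 \<le> n2 * a2 / m2" using 2 by simp
  then have "n1 * a3 / m3 * 1 \<le> n1 * a3 / m3 * (n2 * a2 / m2)"
    using 1 3 by (intro mult_left_mono) auto
  then show ?thesis
    using 1 2 3 by (simp add: G_fun_eq divide_ennreal ennreal_mult[symmetric] ennreal_leI ac_simps)
qed

lemma H_fun_trans: "ennreal (H_fun M t v R1 R3) \<le> ennreal (H_fun M t v R1 R2) * ennreal (H_fun M t v R2 R3)"
  by (simp add: H_fun_eq ennreal_mult[symmetric])

text \<open>Two norm bounds enter each direction, hence the square. The summand 2 comes from R <= 2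
  |Delta(t,R)| when G is bounded by H, the summand \<open>C\<close> from |Delta(t,R)| <= C R in the
  converse.\<close>

definition "ratio_const = cmp\<^sup>2 * (C + 2)"

lemma ratio_const_pos: "0 < ratio_const"
  using cmp_pos C_pos by (simp add: ratio_const_def)

lemma G_H_comparable:
  assumes R: "0 < R" "R \<le> max_dist M t" and x: "0 < x" "x * R \<le> max_dist M t"
  shows "G_fun M p t v (x * R) R \<le> ennreal (ratio_const * x powr (1 / p t)) * ennreal (H_fun M t v (x * R) R)"
    and "ennreal (H_fun M t v (x * R) R) \<le> ennreal (ratio_const * x powr - (1 / p t)) * G_fun M p t v (x * R) R"
proof -
  have xR: "0 < x * R" using R x by simp
  define E1 E2 where "E1 = exp (mean_log (x * R)) * (x * R) powr (1 / p t)"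
    and "E2 = exp (mean_log R) * R powr (1 / p t)"
  have E: "0 < E1" "0 < E2" using R x by (simp_all add: E1_def E2_def)
  obtain n where n: "exp_norm L (annulus M t (x * R)) = ennreal n" "0 < n" "E1 \<le> cmp * n" "n \<le> cmp * E1"
    using annulus_real[OF xR x(2)] unfolding E1_def by metis
  obtain a m where a: "exp_assoc L (annulus M t R) = ennreal a" "emeasure M (annulus M t R) = ennreal m"
    "0 < a" "0 < m" "R / 2 \<le> m" "m \<le> C * R" "R \<le> cmp * a * E2" "a * E2 \<le> cmp * R"
    using annulus_real[OF R] unfolding E2_def by metis
  have G: "G_fun M p t v (x * R) R = ennreal (n * a / m)"
    using n a by (simp add: G_fun_eq divide_ennreal ennreal_mult[symmetric])
  have ratio: "x powr (1 / p t) * H_fun M t v (x * R) R = E1 / E2"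
    using R x by (simp add: H_fun_eq E1_def E2_def powr_mult field_simps)
  have "n * (a * E2) \<le> (cmp * E1) * (cmp * R)"
    by (rule mult_mono) (use n a E cmp_pos in simp_all)
  also have "\<dots> \<le> (cmp * E1) * (cmp * (2 * m))"
    using a E cmp_pos by (intro mult_left_mono) auto
  finally have "n * a * E2 \<le> 2 * cmp\<^sup>2 * E1 * m" by (simp add: power2_eq_square ac_simps)
  then have "n * a / m \<le> 2 * cmp\<^sup>2 * (E1 / E2)" using a E by (simp add: field_simps)
  also have "\<dots> \<le> ratio_const * (E1 / E2)"
    using E C_pos by (intro mult_right_mono) (auto simp: ratio_const_def algebra_simps)
  finally show "G_fun M p t v (x * R) R \<le> ennreal (ratio_const * x powr (1 / p t)) * ennreal (H_fun M t v (x * R) R)"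
    unfolding G ratio[symmetric] using ratio_const_pos
    by (simp add: ennreal_mult[symmetric] ennreal_leI mult.assoc H_fun_eq)
  have "E1 * m \<le> (cmp * n) * (C * (cmp * a * E2))"
    using R n a E cmp_pos C_pos by (intro mult_mono order.trans[OF a(6)]) auto
  then have "E1 * m \<le> C * cmp\<^sup>2 * (n * a) * E2" by (simp add: power2_eq_square ac_simps)
  then have "E1 / E2 \<le> C * cmp\<^sup>2 * (n * a / m)" using a E by (simp add: field_simps)
  also have "\<dots> \<le> ratio_const * (n * a / m)"
    using n a by (intro mult_right_mono) (auto simp: ratio_const_def algebra_simps)
  finally have "x powr (1 / p t) * H_fun M t v (x * R) R \<le> ratio_const * (n * a / m)" unfolding ratio .
  then have *: "x powr - (1 / p t) * (x powr (1 / p t) * H_fun M t v (x * R) R)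
      \<le> x powr - (1 / p t) * (ratio_const * (n * a / m))"
    by (intro mult_left_mono) auto
  have "x powr - (1 / p t) * x powr (1 / p t) = 1" using x by (simp add: powr_minus)
  then have "H_fun M t v (x * R) R = x powr - (1 / p t) * x powr (1 / p t) * H_fun M t v (x * R) R" by simp
  also have "\<dots> = x powr - (1 / p t) * (x powr (1 / p t) * H_fun M t v (x * R) R)" by (rule mult.assoc)
  also note *
  also have "x powr - (1 / p t) * (ratio_const * (n * a / m)) = ratio_const * x powr - (1 / p t) * (n * a / m)"
    by (simp only: mult.assoc mult.left_commute)
  finally have "H_fun M t v (x * R) R \<le> ratio_const * x powr - (1 / p t) * (n * a / m)" .
  then show "ennreal (H_fun M t v (x * R) R) \<le> ennreal (ratio_const * x powr - (1 / p t)) * G_fun M p t v (x * R) R"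
    unfolding G using ratio_const_pos n a
    by (simp add: ennreal_mult[symmetric] ennreal_leI mult.assoc)
qed

text \<open>The hypotheses say that \<open>y\<close> is at most 1, x and 1/x. So the smaller radius
  is at least \<open>y\<close> times the larger one, and both portions are large enough for
  \<open>mean_diff_le\<close> with \<open>k = y / 2\<close>.\<close>

lemma H_fun_le:
  assumes R: "0 < R" "R \<le> max_dist M t" and x: "0 < x" "x * R \<le> max_dist M t"
    and y: "0 < y" "y \<le> 1" "y \<le> x" "y * x \<le> 1"
  shows "H_fun M t v (x * R) R \<le> exp (4 * osc / y)"
proof -
  define S where "S = max (x * R) R"
  have S: "0 < S" "S \<le> max_dist M t" using R x by (auto simp: S_def)
  have "y * S \<le> x * R" "y * S \<le> R"
    using R x y mult_right_mono[of y x R] mult_right_mono[of "y * x" 1 R] mult_right_mono[of y 1 "x * R"]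
      mult_right_mono[of y 1 R] by (auto simp: S_def max_def mult.assoc)
  then have ge: "y / 2 * S \<le> measure M (portion M t (x * R))" "y / 2 * S \<le> measure M (portion M t R)"
    using portion_ge[of "x * R"] portion_ge[OF R] R x by (auto intro: order.trans)
  have "\<bar>mean_log (x * R) - mean_log R\<bar> \<le> 2 * osc / (y / 2)"
    unfolding mean_value_def
    by (rule mean_diff_le[OF S]) (use ge y in \<open>auto simp: S_def intro!: portion_mono portion_sets\<close>)
  then have "mean_log (x * R) - mean_log R \<le> 4 * osc / y" by simp
  then show ?thesis by (simp add: H_fun_eq flip: exp_diff)
qed

lemma V_fun_le:
  assumes x: "0 < x" and y: "0 < y" "y \<le> 1" "y \<le> x" "y * x \<le> 1"
  shows "V_fun M t v x \<le> ennreal (exp (4 * osc / y))"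
  unfolding V_fun_eq_ratio_sup using assms by (intro ratio_sup_le ennreal_leI H_fun_le) auto

lemma Q_fun_le_V_fun:
  assumes x: "0 < x"
  shows "Q_fun M p t v x \<le> ennreal (ratio_const * x powr (1 / p t)) * V_fun M t v x"
  unfolding V_fun_eq_ratio_sup Q_fun_eq_ratio_sup
  using x by (intro ratio_sup_le order.trans[OF G_H_comparable(1)] mult_left_mono
      ratio_sup_upper[where F = "\<lambda>R1 R2. ennreal (H_fun M t v R1 R2)"]) auto

lemma V_fun_le_Q_fun:
  assumes x: "0 < x"
  shows "V_fun M t v x \<le> ennreal (ratio_const * x powr - (1 / p t)) * Q_fun M p t v x"
  unfolding V_fun_eq_ratio_sup Q_fun_eq_ratio_sup
  using x by (intro ratio_sup_le order.trans[OF G_H_comparable(2)] mult_left_mono ratio_sup_upper) auto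

lemma V_fun_pos_finite:
  assumes x: "0 < x"
  shows "0 < V_fun M t v x \<and> V_fun M t v x < \<infinity>"
proof
  \<comment> \<open>Scaled so that \<open>R\<close> and \<open>x * R\<close> are both admissible
    radii, whether or not \<open>x\<close> exceeds 1.\<close>
  define R where "R = min 1 (1 / x) * max_dist M t"
  have R: "0 < R" "R \<le> max_dist M t" "x * R \<le> max_dist M t"
    using x max_dist_pos by (auto simp: R_def min_def mult_left_le_one_le field_simps)
  have "0 < ennreal (H_fun M t v (x * R) R)" by (simp add: H_fun_eq)
  also have "\<dots> \<le> V_fun M t v x"
    unfolding V_fun_eq_ratio_sup
    by (rule ratio_sup_upper[where F = "\<lambda>R1 R2. ennreal (H_fun M t v R1 R2)"]) (use x R in auto)
  finally show "0 < V_fun M t v x" .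
  have "V_fun M t v x \<le> ennreal (exp (4 * osc / min x (1 / x)))"
  proof (intro V_fun_le)
    show "min x (1 / x) \<le> 1" using x by (cases "x \<le> 1") (auto simp: min_le_iff_disj)
    have "min x (1 / x) * x \<le> 1 / x * x" using x by (intro mult_right_mono) auto
    then show "min x (1 / x) * x \<le> 1" using x by simp
  qed (use x in auto)
  then show "V_fun M t v x < \<infinity>" by (rule le_less_trans) simp
qed

lemma Q_fun_pos_finite:
  assumes x: "0 < x"
  shows "0 < Q_fun M p t v x \<and> Q_fun M p t v x < \<infinity>"
proof
  have "Q_fun M p t v x \<noteq> 0" using V_fun_le_Q_fun[OF x] V_fun_pos_finite[OF x] by auto
  then show "0 < Q_fun M p t v x" by (simp add: zero_less_iff_neq_zero)
  have "ennreal (ratio_const * x powr (1 / p t)) * V_fun M t v x < \<infinity>"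
    using V_fun_pos_finite[OF x] by (simp add: ennreal_mult_less_top)
  then show "Q_fun M p t v x < \<infinity>" using Q_fun_le_V_fun[OF x] by (rule le_less_trans[rotated])
qed

text \<open>The choice \<open>y = 1 / 2\<close> is admissible throughout this interval.\<close>

lemma V_fun_near_1: "x \<in> {1/2<..<2} \<Longrightarrow> V_fun M t v x \<le> ennreal (exp (8 * osc))"
  using V_fun_le[of x "1/2"] by simp

lemma regular_V_fun: "regular_function (V_fun M t v)"
  unfolding regular_function_def using V_fun_pos_finite V_fun_near_1
  by (auto intro!: exI[of _ "{1/2<..<2}"] exI[of _ "exp (8 * osc)"])

lemma regular_Q_fun: "regular_function (Q_fun M p t v)"
  unfolding regular_function_def
proof (intro conjI allI impI exI ballI)
  show "0 < Q_fun M p t v x" if "0 < x" for x using Q_fun_pos_finite that by auto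
  fix x :: real assume x: "x \<in> {1/2<..<2}"
  have "x powr (1 / p t) \<le> 2 powr (1 / p t)"
    using x p_nonneg[OF t_in] by (intro powr_mono2) auto
  then have "ennreal (ratio_const * x powr (1 / p t)) * V_fun M t v x
      \<le> ennreal (ratio_const * 2 powr (1 / p t)) * ennreal (exp (8 * osc))"
    using ratio_const_pos by (intro mult_mono V_fun_near_1 x ennreal_leI mult_left_mono) auto
  also have "\<dots> = ennreal (ratio_const * 2 powr (1 / p t) * exp (8 * osc))"
    using ratio_const_pos by (simp add: ennreal_mult[symmetric])
  finally show "Q_fun M p t v x \<le> ennreal (ratio_const * 2 powr (1 / p t) * exp (8 * osc))"
    using Q_fun_le_V_fun[of x] x by simp
qed auto

lemma submultiplicative_Q_fun: "submultiplicative (Q_fun M p t v)"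
  unfolding Q_fun_eq_ratio_sup by (intro ratio_sup_submultiplicative G_fun_trans)

lemma submultiplicative_V_fun: "submultiplicative (V_fun M t v)"
  unfolding V_fun_eq_ratio_sup by (intro ratio_sup_submultiplicative H_fun_trans)

lemma index_eqs:
  "lower_index (Q_fun M p t v) = ereal (1 / p t) + lower_index (V_fun M t v)"
  "upper_index (Q_fun M p t v) = ereal (1 / p t) + upper_index (V_fun M t v)"
  using indices_shift[of "Q_fun M p t v" "V_fun M t v" ratio_const "1 / p t"]
    submultiplicative_Q_fun submultiplicative_V_fun ratio_const_pos Q_fun_pos_finite V_fun_pos_finite
    Q_fun_le_V_fun V_fun_le_Q_fun by auto

end

section \<open>Conclusion\<close>

lemma borel_measurable_length_measure:
  assumes "f \<in> borel_measurable (restrict_space borel (path_image g))"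
  shows "f \<in> borel_measurable (length_measure g)"
proof (rule measurableI)
  fix A :: "'a set" assume "A \<in> sets borel"
  from measurable_sets[OF assms this]
  have "f -` A \<inter> space (length_measure g) \<in> sets (restrict_space borel (path_image g))"
    by (simp add: space_restrict_space)
  then show "f -` A \<inter> space (length_measure g) \<in> sets (length_measure g)"
    by (rule sets_length_measure)
qed simp

lemma max_dist_length_measure_pos:
  assumes "simple_path g"
  shows "0 < max_dist (length_measure g) t"
proof (rule ccontr)
  assume *: "\<not> 0 < max_dist (length_measure g) t"
  have eq: "\<tau> = t" if "\<tau> \<in> path_image g" for \<tau>
    using max_dist_attained(2)[OF simple_path_imp_path[OF assms] that, of t] * norm_ge_zero[of "\<tau> - t"]
    by (metis eq_iff_diff_eq_0 norm_le_zero_iff not_le order.trans)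
  \<comment> \<open>A loop-free path may identify only the parameters 0 and 1, so two interior ones
    give the contradiction.\<close>
  have "g (1/3) = g (1/2)"
    using eq[of "g (1/3)"] eq[of "g (1/2)"] by (simp add: path_image_def)
  moreover have "loop_free g" using assms by (simp add: simple_path_def)
  ultimately show False
    unfolding loop_free_def by (elim ballE[of _ _ "1/3"] ballE[of _ _ "1/2"]) auto
qed

lemma locally_carleson_bound:
  assumes "locally_carleson M t" "finite_measure M"
  obtains C where "\<And>R. 0 < R \<Longrightarrow> measure M (portion M t R) \<le> C * R"
proof -
  interpret finite_measure M by fact
  obtain C where C: "0 \<le> C" "(SUP R\<in>{0<..}. emeasure M (portion M t R) / ennreal R) = ennreal C"
    using assms(1) unfolding locally_carleson_def by (metis ennreal_cases infinity_ennreal_def less_irrefl)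
  have "measure M (portion M t R) \<le> C * R" if R: "0 < R" for R
  proof -
    have "emeasure M (portion M t R) / ennreal R \<le> ennreal C"
      unfolding C(2)[symmetric] using R by (intro SUP_upper) auto
    then have "ennreal (measure M (portion M t R) / R) \<le> ennreal C"
      using R by (simp add: emeasure_eq_measure divide_ennreal)
    then show ?thesis using C R by (simp add: ennreal_le_iff divide_le_eq)
  qed
  then show ?thesis using that by blast
qed

text \<open>For \<open>R < 1 / 2\<close> the point is closer than \<open>R\<close>, so |ln R| is at
  most -ln |\<tau> - t| off t and the log-Hoelder condition gives \<open>A\<close>. For larger
  \<open>R\<close> both factors are bounded, the exponent by compactness.\<close>

lemma log_hoelder_osc:
  assumes p: "p \<in> exponent_class M t" and compact: "compact (space M)" and t: "t \<in> space M" and d: "0 \<le> d"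
  obtains B where "\<And>R \<tau>. 0 < R \<Longrightarrow> R \<le> d + 1 \<Longrightarrow> \<tau> \<in> portion M t R \<Longrightarrow> \<bar>p \<tau> - p t\<bar> * \<bar>ln R\<bar> \<le> B"
proof -
  obtain A where A: "0 < A" "\<And>\<tau>. \<tau> \<in> portion M t (1/2) \<Longrightarrow> \<bar>p \<tau> - p t\<bar> \<le> A / (- ln (cmod (\<tau> - t)))"
    using p unfolding exponent_class_def by blast
  have "continuous_on (space M) p" using p by (simp add: exponent_class_def)
  then have "bounded (p ` space M)" by (intro compact_imp_bounded compact_continuous_image compact)
  then obtain P where P: "\<And>\<tau>. \<tau> \<in> space M \<Longrightarrow> \<bar>p \<tau>\<bar> \<le> P" by (auto simp: bounded_iff)
  have P0: "0 \<le> P" using P[OF t] by simp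
  show ?thesis
  proof (rule that[of "A + 2 * P * (ln 2 + ln (d + 1))"])
    fix R \<tau> assume R: "0 < R" "R \<le> d + 1" and \<tau>: "\<tau> \<in> portion M t R"
    have space: "\<tau> \<in> space M" using \<tau> by (simp add: portion_def)
    have ln0: "0 \<le> ln 2 + ln (d + 1)" using d by (intro add_nonneg_nonneg) auto
    show "\<bar>p \<tau> - p t\<bar> * \<bar>ln R\<bar> \<le> A + 2 * P * (ln 2 + ln (d + 1))"
    proof (cases "R < 1 / 2")
      case True
      have "\<bar>p \<tau> - p t\<bar> * \<bar>ln R\<bar> \<le> A"
      proof (cases "\<tau> = t")
        case False
        define r where "r = cmod (\<tau> - t)"
        have r: "0 < r" "r < R" using False \<tau> by (auto simp: r_def portion_def)
        have neg: "ln R < 0" "ln r < ln R" using r R True by auto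
        have "\<bar>p \<tau> - p t\<bar> * \<bar>ln R\<bar> \<le> A / (- ln r) * \<bar>ln R\<bar>"
          using A(2)[of \<tau>] \<tau> True by (intro mult_right_mono) (auto simp: r_def portion_def)
        also have "\<dots> = A * (\<bar>ln R\<bar> / (- ln r))" by simp
        also have "\<dots> \<le> A * 1" using neg A(1) by (intro mult_left_mono) (auto simp: divide_le_eq)
        finally show ?thesis by simp
      qed (use A in simp)
      moreover have "0 \<le> 2 * P * (ln 2 + ln (d + 1))" using P0 ln0 by simp
      ultimately show ?thesis by linarith
    next
      case False
      have "ln (1 / 2) \<le> ln R" "ln R \<le> ln (d + 1)" using False R by (subst ln_le_cancel_iff; simp)+
      moreover have "ln (1 / 2) = - ln (2::real)" by (simp add: ln_div)
      moreover have "0 \<le> ln (d + 1)" "0 \<le> ln (2::real)" using d by auto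
      ultimately have "\<bar>ln R\<bar> \<le> ln 2 + ln (d + 1)" by linarith
      moreover have "\<bar>p \<tau> - p t\<bar> \<le> 2 * P" using P[OF space] P[OF t] by linarith
      ultimately have "\<bar>p \<tau> - p t\<bar> * \<bar>ln R\<bar> \<le> 2 * P * (ln 2 + ln (d + 1))" using P0 by (intro mult_mono) auto
      then show ?thesis using A(1) by linarith
    qed
  qed
qed

theorem lemma5p17:
  fixes g :: "real \<Rightarrow> complex" and t :: complex
    and p :: "complex \<Rightarrow> real" and w :: "complex \<Rightarrow> ennreal"
    and \<theta> :: "complex \<Rightarrow> real" and \<gamma> :: complex
  assumes "rectifiable_jordan_curve g"
    and "t \<in> path_image g"
    and "locally_carleson (length_measure g) t"
    and "p \<in> exponent_class (length_measure g) t"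
    and "w \<in> muckenhoupt_class (length_measure g) p t"
    and "arg_branch (length_measure g) t \<theta>"
    and "\<gamma> \<in> indicator_set_N (length_measure g) p t \<theta> w"
  shows "indices_well_defined (length_measure g) p t \<theta> w (Im \<gamma>) \<and>
         alpha_star (length_measure g) p t \<theta> w (Im \<gamma>)
           = ereal (1 / p t) + alpha (length_measure g) t \<theta> w (Im \<gamma>) \<and>
         beta_star (length_measure g) p t \<theta> w (Im \<gamma>)
           = ereal (1 / p t) + beta (length_measure g) t \<theta> w (Im \<gamma>)"
proof -
  define M where "M = length_measure g"
  define v where "v = eta_weight \<theta> w (Im \<gamma>)"
  define u where "u \<tau> = ennreal (phi t \<theta> \<gamma> \<tau>) * w \<tau>" for \<tau>
  define \<kappa> where "\<kappa> = Re \<gamma>"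
  have g: "simple_path g" "path g" "rectifiable_path g"
    using assms(1) by (auto simp: rectifiable_jordan_curve_def simple_path_imp_path)
  have space: "space M = path_image g" by (simp add: M_def)
  have t: "t \<in> space M" using assms(2) space by simp
  interpret finite_measure M unfolding M_def by (rule finite_measure_length_measure[OF g(2,3)])
  have id_meas [measurable]: "(\<lambda>\<tau>. \<tau>) \<in> borel_measurable M"
    unfolding M_def by (intro borel_measurable_length_measure measurable_restrict_space1) simp
  have p_meas: "p \<in> borel_measurable M"
    using assms(4) unfolding M_def exponent_class_def
    by (intro borel_measurable_length_measure borel_measurable_continuous_on_restrict) simp
  obtain C where C: "\<And>R. 0 < R \<Longrightarrow> measure M (portion M t R) \<le> C * R"
    using locally_carleson_bound[OF assms(3)] finite_measure_axioms unfolding M_def by blast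
  have d_pos: "0 < max_dist M t" unfolding M_def by (rule max_dist_length_measure_pos[OF g(1)])
  have "compact (space M)" unfolding space by (rule compact_path_image[OF g(2)])
  then obtain B where B: "\<And>R \<tau>. 0 < R \<Longrightarrow> R \<le> max_dist M t + 1 \<Longrightarrow> \<tau> \<in> portion M t R \<Longrightarrow> \<bar>p \<tau> - p t\<bar> * \<bar>ln R\<bar> \<le> B"
    using log_hoelder_osc[of p M t "max_dist M t"] assms(4) t d_pos unfolding M_def by (metis less_imp_le)
  interpret carleson_point M t p C B
  proof
    show "cmod (\<tau> - t) \<le> max_dist M t" if "\<tau> \<in> space M" for \<tau>
      using max_dist_attained(2)[OF g(2)] that unfolding M_def by simp
    show "R / 2 \<le> measure M (annulus M t R)" if "0 < R" "R \<le> max_dist M t" for R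
      using measure_annulus_ge[OF g(2,3) assms(2)] that unfolding M_def[symmetric]
      by (simp add: emeasure_eq_measure ennreal_le_iff)
    show "1 \<le> p \<tau>" if "\<tau> \<in> space M" for \<tau>
      using assms(4) that unfolding M_def exponent_class_def by force
  qed (use t d_pos C p_meas B id_meas in auto)
  have u: "weight M u" and u_muck: "(SUP R\<in>{0<..}. ennreal (1 / R) *
            nakano_norm M p (\<lambda>\<tau>. u \<tau> * indicator (portion M t R) \<tau>) *
            associate_norm M p (\<lambda>\<tau>. indicator (portion M t R) \<tau> / u \<tau>)) < \<infinity>"
    using assms(7) unfolding M_def[symmetric] indicator_set_N_def muckenhoupt_class_def u_def by auto
  have u_meas [measurable]: "u \<in> borel_measurable M" and u_AE: "AE \<tau> in M. 0 < u \<tau> \<and> u \<tau> < \<infinity>"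
    using u by (auto simp: weight_def)
  have u_v: "u \<tau> = ennreal (cmod (\<tau> - t) powr \<kappa>) * v \<tau>" for \<tau>
    by (simp add: u_def v_def eta_weight_def phi_def \<kappa>_def ennreal_mult mult.assoc)
  \<comment> \<open>\<open>0 powr a = 0\<close> for every \<open>a\<close>, so positivity of
    \<open>u\<close> almost everywhere discards \<open>t\<close>, where the convention
    \<open>ln 0 = 0\<close> spoils the exponential form of \<open>u\<close>.\<close>
  have u_t: "u t = 0" by (simp add: u_v)
  have v_meas [measurable]: "v \<in> borel_measurable M"
  proof -
    \<comment> \<open>Off \<open>t\<close> the power of the distance can be divided out of
      \<open>u\<close>, and the single point \<open>t\<close> takes a constant; so measurability
      passes from \<open>u\<close> to \<open>v\<close>.\<close>
    have "v \<tau> = (if \<tau> = t then v t else ennreal (cmod (\<tau> - t) powr - \<kappa>) * u \<tau>)" for \<tau>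
      by (simp add: u_v mult.assoc[symmetric] ennreal_mult[symmetric] powr_minus)
    then have "v = (\<lambda>\<tau>. if \<tau> = t then v t else ennreal (cmod (\<tau> - t) powr - \<kappa>) * u \<tau>)" by blast
    moreover have "\<dots> \<in> borel_measurable M" by measurable
    ultimately show ?thesis by simp
  qed
  have log_meas [measurable]: "log_weight v \<in> borel_measurable M"
    unfolding log_weight_def[abs_def] by measurable
  have "AE \<tau> in M. v \<tau> = ennreal (exp (log_weight v \<tau>)) \<and>
      u \<tau> = ennreal (exp (log_weight v \<tau> + \<kappa> * ln (cmod (\<tau> - t))))"
    using u_AE
  proof eventually_elim
    case (elim \<tau>)
    then have \<tau>: "\<tau> \<noteq> t" using u_t by auto
    then have pos: "0 < cmod (\<tau> - t) powr \<kappa>" by simp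
    have "v \<tau> \<noteq> 0" "v \<tau> \<noteq> \<infinity>"
      using elim pos by (auto simp: u_v ennreal_mult_top)
    then obtain r where r: "v \<tau> = ennreal r" "0 < r" by (cases "v \<tau>") (auto simp: less_le)
    then have exp_r: "exp (log_weight v \<tau>) = r" by (simp add: log_weight_def)
    have "cmod (\<tau> - t) powr \<kappa> = exp (\<kappa> * ln (cmod (\<tau> - t)))" using \<tau> by (simp add: powr_def)
    then show ?case using r exp_r by (simp add: u_v exp_add ennreal_mult[symmetric] mult.commute)
  qed
  then have v_AE: "AE \<tau> in M. v \<tau> = ennreal (exp (log_weight v \<tau>))"
    and u_exp: "AE \<tau> in M. u \<tau> = ennreal (exp (log_weight v \<tau> + \<kappa> * ln (cmod (\<tau> - t))))"
    by (auto elim: eventually_mono)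
  obtain D where D: "0 \<le> D" "(SUP R\<in>{0<..}. ennreal (1 / R) *
            nakano_norm M p (\<lambda>\<tau>. u \<tau> * indicator (portion M t R) \<tau>) *
            associate_norm M p (\<lambda>\<tau>. indicator (portion M t R) \<tau> / u \<tau>)) = ennreal D"
    using u_muck unfolding infinity_ennreal_def less_top_ennreal by blast
  \<comment> \<open>\<open>D\<close> may be 0, whereas the locale asks for a positive constant;
    hence \<open>D + 1\<close>.\<close>
  have muck: "exp_norm (\<lambda>\<tau>. log_weight v \<tau> + \<kappa> * ln (cmod (\<tau> - t))) (portion M t R) *
      exp_assoc (\<lambda>\<tau>. log_weight v \<tau> + \<kappa> * ln (cmod (\<tau> - t))) (portion M t R) \<le> ennreal ((D + 1) * R)"
    (is "?N * ?A \<le> _") if R: "0 < R" for R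
  proof -
    let ?S = "portion M t R"
    have N: "?N \<le> nakano_norm M p (\<lambda>\<tau>. u \<tau> * indicator ?S \<tau>)"
      unfolding exp_norm_def
      by (rule nakano_norm_mono[OF eventually_mono[OF u_exp]]) (simp_all add: p_nonneg)
    have A: "?A \<le> associate_norm M p (\<lambda>\<tau>. indicator ?S \<tau> / u \<tau>)"
      unfolding exp_assoc_def
    proof (rule associate_norm_mono)
      show "AE \<tau> in M. ennreal (exp (- (log_weight v \<tau> + \<kappa> * ln (cmod (\<tau> - t))))) * indicator ?S \<tau> \<le> indicator ?S \<tau> / u \<tau>"
        using u_exp
      proof eventually_elim
        case (elim \<tau>)
        have "indicator ?S \<tau> / ennreal (exp y) = ennreal (exp (- y)) * indicator ?S \<tau>" for y :: real
          by (simp add: divide_ennreal_def inverse_ennreal exp_minus mult.commute)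
        then show ?case using elim by simp
      qed
    qed
    have "ennreal (1 / R) * ?N * ?A \<le> ennreal D"
      unfolding D(2)[symmetric]
      by (rule SUP_upper2[of R]) (use R in simp, intro mult_mono N A order_refl zero_le)
    then have "ennreal R * (ennreal (1 / R) * ?N * ?A) \<le> ennreal R * ennreal D" by (rule mult_left_mono) simp
    also have "ennreal R * (ennreal (1 / R) * ?N * ?A) = ennreal (R * (1 / R)) * (?N * ?A)"
      using R by (simp only: ennreal_mult mult.assoc less_imp_le zero_le_divide_1_iff)
    also have "\<dots> = ?N * ?A" using R by simp
    also have "ennreal R * ennreal D \<le> ennreal ((D + 1) * R)"
      using R D(1) by (simp add: ennreal_mult[symmetric] ennreal_leI algebra_simps)
    finally show ?thesis .
  qed
  interpret carleson_ennreal_weight M t p C B v \<kappa> "D + 1"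
  proof
    show "AE \<tau> in M. v \<tau> = ennreal (exp (log_weight v \<tau>))" by (rule v_AE)
    show "0 < D + 1" using D(1) by simp
  qed (rule log_meas, rule muck)
  show ?thesis
    using L_integrable regular_Q_fun regular_V_fun submultiplicative_Q_fun submultiplicative_V_fun index_eqs
    unfolding indices_well_defined_def alpha_star_def alpha_def beta_star_def beta_def
      M_def[symmetric] v_def[symmetric] by auto
qed

end
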